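(* Let $A$ be an MV-algebra. The following conditions are equivalent: (1) $A$ is quasihyperarchimedean. (2) For all $a \in A$, the set $W^c_a = \{\chi \in X_A \mid \chi(a)=0\}$ is open in $X_A$ (thus clopen). (3) The map $X_A \to X^c_A \cong M_A$ (the identity on underlying sets, followed by $\chi \mapsto \ker \chi$) is continuous (thus a homeomorphism). (4) The maximal spectrum $X^c_A \cong M_A$ is compact.
   Context: In an MV-algebra $(A,\oplus,\neg,0)$ put $1=\neg 0$, $x\odot y=\neg(\neg x\oplus\neg y)$, $x\ominus y=x\odot\neg y$, $x\le y$ iff $x\ominus y=0$, and $na=a\oplus\cdots\oplus a$ ($n$ times, $0a=0$). The interval $[0,1]$ is an MV-algebra with $x\oplus y=\min(1,x+y)$, $\neg x=1-x$. An element $a\in A$ is infinitesimal if $na\le\neg a$ for every integer $n\ge 0$ (so $0$ is infinitesimal). An element $a$ is quasiarchimedean if there is an integer $n\ge 0$ such that $(n+1)a\ominus na$ is infinitesimal. $A$ is quasihyperarchimedean if every element of $A$ is quasiarchimedean. $X_A\subset[0,1]^A$ is the set of MV-algebra morphisms $A\to[0,1]$ with the topology inherited from the product space $[0,1]^A$; it is compact Hausdorff and the sets $W_a=\{\chi\mid\chi(a)>0\}$, $a\in A$, form a base of its topology. $X^c_A$ is the same set with the coZariski topology, which has as a base of open sets the sets $W^c_a=\{\chi\mid\chi(a)=0\}$, $a\in A$. $M_A$ is the set of maximal ideals of $A$ with the topology having as base of open sets the sets $\{M\in M_A\mid a\in M\}$, $a\in A$ (the subspace topology from the prime spectrum of $A$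 with its coZariski topology); $\chi\mapsto\ker\chi=\chi^{-1}(0)$ is a homeomorphism $X^c_A\cong M_A$. *)

theory Defs
  imports "HOL-Analysis.Analysis"
begin

record 'a mv_structure =
  mv_carrier :: "'a set"
  mv_plus :: "'a \<Rightarrow> 'a \<Rightarrow> 'a"
  mv_neg :: "'a \<Rightarrow> 'a"
  mv_zero :: "'a"

locale mv_algebra =
  fixes A :: "('a, 'b) mv_structure_scheme"
  assumes zero_closed: "mv_zero A \<in> mv_carrier A"
    and plus_closed: "\<lbrakk>x \<in> mv_carrier A; y \<in> mv_carrier A\<rbrakk> \<Longrightarrow> mv_plus A x y \<in> mv_carrier A"
    and neg_closed: "x \<in> mv_carrier A \<Longrightarrow> mv_neg A x \<in> mv_carrier A"
    and plus_assoc: "\<lbrakk>x \<in> mv_carrier A; y \<in> mv_carrier A; z \<in> mv_carrier A\<rbrakk>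
      \<Longrightarrow> mv_plus A (mv_plus A x y) z = mv_plus A x (mv_plus A y z)"
    and plus_comm: "\<lbrakk>x \<in> mv_carrier A; y \<in> mv_carrier A\<rbrakk> \<Longrightarrow> mv_plus A x y = mv_plus A y x"
    and plus_zero: "x \<in> mv_carrier A \<Longrightarrow> mv_plus A x (mv_zero A) = x"
    and neg_neg: "x \<in> mv_carrier A \<Longrightarrow> mv_neg A (mv_neg A x) = x"
    and plus_neg_zero: "x \<in> mv_carrier A
      \<Longrightarrow> mv_plus A x (mv_neg A (mv_zero A)) = mv_neg A (mv_zero A)"
    and lukasiewicz: "\<lbrakk>x \<in> mv_carrier A; y \<in> mv_carrier A\<rbrakk>
      \<Longrightarrow> mv_plus A (mv_neg A (mv_plus A (mv_neg A x) y)) y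
        = mv_plus A (mv_neg A (mv_plus A (mv_neg A y) x)) x"

definition mv_times :: "('a, 'b) mv_structure_scheme \<Rightarrow> 'a \<Rightarrow> 'a \<Rightarrow> 'a" where
  "mv_times A x y = mv_neg A (mv_plus A (mv_neg A x) (mv_neg A y))"

definition mv_minus :: "('a, 'b) mv_structure_scheme \<Rightarrow> 'a \<Rightarrow> 'a \<Rightarrow> 'a" where
  "mv_minus A x y = mv_times A x (mv_neg A y)"

definition mv_le :: "('a, 'b) mv_structure_scheme \<Rightarrow> 'a \<Rightarrow> 'a \<Rightarrow> bool" where
  "mv_le A x y \<longleftrightarrow> mv_minus A x y = mv_zero A"

primrec mv_multiple :: "('a, 'b) mv_structure_scheme \<Rightarrow> nat \<Rightarrow> 'a \<Rightarrow> 'a" where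
  "mv_multiple A 0 a = mv_zero A"
| "mv_multiple A (Suc n) a = mv_plus A (mv_multiple A n a) a"

definition infinitesimal :: "('a, 'b) mv_structure_scheme \<Rightarrow> 'a \<Rightarrow> bool" where
  "infinitesimal A a \<longleftrightarrow> (\<forall>n. mv_le A (mv_multiple A n a) (mv_neg A a))"

definition quasiarchimedean :: "('a, 'b) mv_structure_scheme \<Rightarrow> 'a \<Rightarrow> bool" where
  "quasiarchimedean A a \<longleftrightarrow>
    (\<exists>n. infinitesimal A (mv_minus A (mv_multiple A (n + 1) a) (mv_multiple A n a)))"

definition quasihyperarchimedean :: "('a, 'b) mv_structure_scheme \<Rightarrow> bool" where
  "quasihyperarchimedean A \<longleftrightarrow> (\<forall>a\<in>mv_carrier A. quasiarchimedean A a)"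

definition mv_unit_interval :: "real mv_structure" where
  "mv_unit_interval = \<lparr>mv_carrier = {0..1}, mv_plus = (\<lambda>x y. min 1 (x + y)),
    mv_neg = (\<lambda>x. 1 - x), mv_zero = 0\<rparr>"

lemma mv_algebra_unit_interval: "mv_algebra mv_unit_interval"
  unfolding mv_unit_interval_def by unfold_locales (auto simp: min_def)

text \<open>Morphisms are extensional, so that a morphism is determined by its values on the carrier.\<close>

definition mv_hom ::
  "('a, 'b) mv_structure_scheme \<Rightarrow> ('c, 'd) mv_structure_scheme \<Rightarrow> ('a \<Rightarrow> 'c) set" where
  "mv_hom A B = {f \<in> mv_carrier A \<rightarrow>\<^sub>E mv_carrier B.
    f (mv_zero A) = mv_zero B \<and>
    (\<forall>x\<in>mv_carrier A. f (mv_neg A x) = mv_neg B (f x)) \<and>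
    (\<forall>x\<in>mv_carrier A. \<forall>y\<in>mv_carrier A. f (mv_plus A x y) = mv_plus B (f x) (f y))}"

definition mv_characters :: "('a, 'b) mv_structure_scheme \<Rightarrow> ('a \<Rightarrow> real) set" where
  "mv_characters A = mv_hom A mv_unit_interval"

definition character_space :: "('a, 'b) mv_structure_scheme \<Rightarrow> ('a \<Rightarrow> real) topology" where
  "character_space A =
    subtopology (product_topology (\<lambda>_. top_of_set {0..1}) (mv_carrier A)) (mv_characters A)"

definition zero_locus :: "('a, 'b) mv_structure_scheme \<Rightarrow> 'a \<Rightarrow> ('a \<Rightarrow> real) set" where
  "zero_locus A a = {h \<in> mv_characters A. h a = 0}"

text \<open>
  The generating families of the next two topologies are closed under binary intersection
  and contain the whole space, hence are bases and not merely subbases; see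
  \<open>openin_coZariski_character_space\<close> and \<open>openin_maximal_spectrum\<close> below.
\<close>

definition coZariski_character_space ::
  "('a, 'b) mv_structure_scheme \<Rightarrow> ('a \<Rightarrow> real) topology" where
  "coZariski_character_space A = topology_generated_by (zero_locus A ` mv_carrier A)"

definition mv_ideal :: "('a, 'b) mv_structure_scheme \<Rightarrow> 'a set \<Rightarrow> bool" where
  "mv_ideal A I \<longleftrightarrow> I \<subseteq> mv_carrier A \<and> mv_zero A \<in> I \<and>
    (\<forall>x\<in>I. \<forall>y\<in>I. mv_plus A x y \<in> I) \<and>
    (\<forall>x\<in>I. \<forall>y\<in>mv_carrier A. mv_le A y x \<longrightarrow> y \<in> I)"

definition maximal_ideals :: "('a, 'b) mv_structure_scheme \<Rightarrow> 'a set set" where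
  "maximal_ideals A = {M. mv_ideal A M \<and> M \<noteq> mv_carrier A \<and>
    (\<forall>I. mv_ideal A I \<longrightarrow> M \<subseteq> I \<longrightarrow> I = M \<or> I = mv_carrier A)}"

definition maximal_spectrum :: "('a, 'b) mv_structure_scheme \<Rightarrow> 'a set topology" where
  "maximal_spectrum A =
    topology_generated_by ((\<lambda>a. {M \<in> maximal_ideals A. a \<in> M}) ` mv_carrier A)"

definition character_kernel :: "('a, 'b) mv_structure_scheme \<Rightarrow> ('a \<Rightarrow> real) \<Rightarrow> 'a set" where
  "character_kernel A h = {a \<in> mv_carrier A. h a = 0}"

lemma openin_topology_generated_by_base:
  assumes int: "\<And>a b. a \<in> S \<Longrightarrow> b \<in> S \<Longrightarrow> \<exists>c\<in>S. F a \<inter> F b = F c"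
  shows "openin (topology_generated_by (F ` S)) U \<longleftrightarrow> (\<exists>T\<subseteq>S. U = (\<Union>a\<in>T. F a))"
proof
  assume "openin (topology_generated_by (F ` S)) U"
  then have "generate_topology_on (F ` S) U"
    by (simp add: openin_topology_generated_by_iff)
  then show "\<exists>T\<subseteq>S. U = (\<Union>a\<in>T. F a)"
  proof induction
    case Empty
    show ?case by (rule exI[of _ "{}"]) simp
  next
    case (Int U V)
    then obtain T T' where T: "T \<subseteq> S" "U = (\<Union>a\<in>T. F a)" and T': "T' \<subseteq> S" "V = (\<Union>a\<in>T'. F a)"
      by blast
    have eq: "U \<inter> V = (\<Union>a\<in>{c \<in> S. F c \<subseteq> U \<inter> V}. F a)"
    proof
      show "U \<inter> V \<subseteq> (\<Union>a\<in>{c \<in> S. F c \<subseteq> U \<inter> V}. F a)"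
      proof
        fix x assume "x \<in> U \<inter> V"
        then obtain a b where ab: "a \<in> T" "x \<in> F a" "b \<in> T'" "x \<in> F b"
          using T T' by blast
        then obtain c where "c \<in> S" "F a \<inter> F b = F c"
          using int T T' by blast
        moreover have "F a \<inter> F b \<subseteq> U \<inter> V" using ab T T' by blast
        ultimately show "x \<in> (\<Union>a\<in>{c \<in> S. F c \<subseteq> U \<inter> V}. F a)" using ab by auto
      qed
    qed blast
    then show ?case by (intro exI[of _ "{c \<in> S. F c \<subseteq> U \<inter> V}"]) blast
  next
    case (UN K)
    have "\<Union>K = (\<Union>a\<in>{c \<in> S. F c \<subseteq> \<Union>K}. F a)"
    proof
      show "\<Union>K \<subseteq> (\<Union>a\<in>{c \<in> S. F c \<subseteq> \<Union>K}. F a)"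
      proof
        fix x assume "x \<in> \<Union>K"
        then obtain k where k: "k \<in> K" "x \<in> k" by blast
        then obtain T where "T \<subseteq> S" "k = (\<Union>a\<in>T. F a)" using UN by blast
        with k show "x \<in> (\<Union>a\<in>{c \<in> S. F c \<subseteq> \<Union>K}. F a)" by blast
      qed
    qed blast
    then show ?case by (intro exI[of _ "{c \<in> S. F c \<subseteq> \<Union>K}"]) blast
  next
    case (Basis s)
    then obtain a where "a \<in> S" "s = F a" by blast
    then show ?case by (intro exI[of _ "{a}"]) simp
  qed
next
  assume "\<exists>T\<subseteq>S. U = (\<Union>a\<in>T. F a)"
  then show "openin (topology_generated_by (F ` S)) U"
    using topology_generated_by_Basis[of _ "F ` S"] by (blast intro: openin_Union)
qed

context mv_algebra
begin

lemma le_plus1: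
  assumes x: "x \<in> mv_carrier A" and y: "y \<in> mv_carrier A"
  shows "mv_le A x (mv_plus A x y)"
proof -
  have nx: "mv_neg A x \<in> mv_carrier A" and z: "mv_neg A (mv_zero A) \<in> mv_carrier A"
    using x neg_closed zero_closed by auto
  have one: "mv_plus A (mv_neg A x) x = mv_neg A (mv_zero A)"
    using lukasiewicz[OF z x] neg_neg[OF zero_closed] plus_neg_zero[OF x] plus_neg_zero[OF nx]
      plus_comm[OF zero_closed x] plus_zero[OF x] plus_neg_zero[OF zero_closed] by metis
  have "mv_plus A (mv_neg A x) (mv_plus A x y) = mv_neg A (mv_zero A)"
    using plus_assoc[OF nx x y] one plus_comm[OF z y] plus_neg_zero[OF y] by simp
  then show ?thesis
    using x y by (simp add: mv_le_def mv_minus_def mv_times_def neg_neg plus_closed zero_closed)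
qed

lemma openin_coZariski_character_space:
  "openin (coZariski_character_space A) U \<longleftrightarrow>
    (\<exists>S\<subseteq>mv_carrier A. U = (\<Union>a\<in>S. zero_locus A a))"
  unfolding coZariski_character_space_def
proof (rule openin_topology_generated_by_base)
  fix a b assume ab: "a \<in> mv_carrier A" "b \<in> mv_carrier A"
  have "zero_locus A a \<inter> zero_locus A b = zero_locus A (mv_plus A a b)"
  proof -
    have "h (mv_plus A a b) = min 1 (h a + h b) \<and> h a \<ge> 0 \<and> h b \<ge> 0"
      if "h \<in> mv_characters A" for h
      using that ab by (auto simp: mv_characters_def mv_hom_def mv_unit_interval_def PiE_iff)
    then show ?thesis by (fastforce simp: zero_locus_def min_def split: if_splits)
  qed
  then show "\<exists>c\<in>mv_carrier A. zero_locus A a \<inter> zero_locus A b = zero_locus A c"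
    using ab plus_closed by blast
qed

lemma topspace_coZariski_character_space:
  "topspace (coZariski_character_space A) = mv_characters A"
proof -
  have "zero_locus A (mv_zero A) = mv_characters A"
    by (auto simp: zero_locus_def mv_characters_def mv_hom_def mv_unit_interval_def)
  then show ?thesis using zero_closed
    by (auto simp: coZariski_character_space_def topology_generated_by_topspace zero_locus_def)
qed

lemma openin_maximal_spectrum:
  "openin (maximal_spectrum A) U \<longleftrightarrow>
    (\<exists>S\<subseteq>mv_carrier A. U = (\<Union>a\<in>S. {M \<in> maximal_ideals A. a \<in> M}))"
  unfolding maximal_spectrum_def
proof (rule openin_topology_generated_by_base)
  fix a b assume ab: "a \<in> mv_carrier A" "b \<in> mv_carrier A"
  have "mv_plus A a b \<in> M \<longleftrightarrow> a \<in> M \<and> b \<in> M" if "M \<in> maximal_ideals A" for M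
  proof -
    have M: "mv_ideal A M" using that by (simp add: maximal_ideals_def)
    have "mv_le A a (mv_plus A a b)" "mv_le A b (mv_plus A a b)"
      using le_plus1 ab plus_comm by metis+
    with M ab show ?thesis unfolding mv_ideal_def by blast
  qed
  then have "{M \<in> maximal_ideals A. a \<in> M} \<inter> {M \<in> maximal_ideals A. b \<in> M}
      = {M \<in> maximal_ideals A. mv_plus A a b \<in> M}"
    by blast
  then show "\<exists>c\<in>mv_carrier A. {M \<in> maximal_ideals A. a \<in> M} \<inter> {M \<in> maximal_ideals A. b \<in> M}
      = {M \<in> maximal_ideals A. c \<in> M}"
    using ab plus_closed by blast
qed

lemma topspace_maximal_spectrum: "topspace (maximal_spectrum A) = maximal_ideals A"
  using zero_closed
  by (auto simp: maximal_spectrum_def topology_generated_by_topspace maximal_ideals_def mv_ideal_def)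

end

end

theory Submission
  imports Defs
begin

text \<open>
  Everything reduces to two facts about characters. First, \<open>\<chi> \<mapsto> ker \<chi>\<close> is a bijection onto
  the maximal ideals. It is injective since \<open>ker \<chi>\<close> determines whether \<open>\<chi>(a) \<le> 1/2\<close>, hence, by
  repeated doubling, every binary digit of \<open>\<chi>(a)\<close>. It is surjective since the quotient by a maximal
  ideal is a chain, and on a chain the number with those binary digits depends additively on \<open>a\<close>:
  one doubling step halves the additivity error. Second, \<open>a\<close> is infinitesimal iff all characters
  vanish at \<open>a\<close>: if \<open>na \<le> \<not>a\<close> fails, then \<open>\<not>a \<ominus> na\<close> generates a proper ideal, as it is disjoint from
  the nonzero element \<open>na \<ominus> \<not>a\<close>, and a maximal ideal above it omits \<open>a\<close>.

  Consequently \<open>a\<close> is quasiarchimedean iff for some \<open>n\<close> every \<open>\<chi>(a)\<close> is either \<open>0\<close> or at least \<open>1/n\<close>.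
  This makes the zero locus of \<open>a\<close> open, and it follows from compactness applied to the
  cover by the zero loci of \<open>a\<close> and of the \<open>\<not>(na)\<close>.
\<close>

section \<open>Arithmetic of MV-algebras\<close>

context mv_algebra
begin

abbreviation carr ("\<C>") where "\<C> \<equiv> mv_carrier A"
abbreviation zer ("\<zero>") where "\<zero> \<equiv> mv_zero A"
abbreviation one ("\<one>") where "\<one> \<equiv> mv_neg A (mv_zero A)"
abbreviation pls (infixl "\<oplus>" 65) where "x \<oplus> y \<equiv> mv_plus A x y"
abbreviation mns (infixl "\<ominus>" 65) where "x \<ominus> y \<equiv> mv_minus A x y"
abbreviation ngt ("\<sim> _" [81] 80) where "\<sim> x \<equiv> mv_neg A x"
abbreviation leq (infix "\<sqsubseteq>" 50) where "x \<sqsubseteq> y \<equiv> mv_le A x y"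

lemmas closed [simp] = zero_closed plus_closed neg_closed
lemmas [simp] = plus_zero neg_neg plus_neg_zero

lemma minus_eq: "\<lbrakk>x \<in> \<C>; y \<in> \<C>\<rbrakk> \<Longrightarrow> x \<ominus> y = \<sim> (\<sim> x \<oplus> y)"
  by (simp add: mv_minus_def mv_times_def)

lemma minus_closed [simp]: "\<lbrakk>x \<in> \<C>; y \<in> \<C>\<rbrakk> \<Longrightarrow> x \<ominus> y \<in> \<C>"
  by (simp add: minus_eq)

lemma multiple_closed [simp]: "a \<in> \<C> \<Longrightarrow> mv_multiple A n a \<in> \<C>"
  by (induction n) auto

lemma plus_left_comm:
  "\<lbrakk>x \<in> \<C>; y \<in> \<C>; z \<in> \<C>\<rbrakk> \<Longrightarrow> x \<oplus> (y \<oplus> z) = y \<oplus> (x \<oplus> z)"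
  by (metis plus_assoc plus_comm)

lemmas plus_ac = plus_assoc plus_comm plus_left_comm

lemma zero_plus [simp]: "x \<in> \<C> \<Longrightarrow> \<zero> \<oplus> x = x"
  by (metis plus_comm plus_zero zero_closed)

lemma one_plus [simp]: "x \<in> \<C> \<Longrightarrow> \<one> \<oplus> x = \<one>"
  by (metis plus_comm plus_neg_zero zero_closed neg_closed)

section \<open>The natural order and truncated subtraction\<close>

lemma le_iff: "\<lbrakk>x \<in> \<C>; y \<in> \<C>\<rbrakk> \<Longrightarrow> x \<sqsubseteq> y \<longleftrightarrow> \<sim> x \<oplus> y = \<one>"
  by (metis mv_le_def minus_eq neg_neg closed)

lemma le_plus [simp]: "\<lbrakk>x \<in> \<C>; y \<in> \<C>\<rbrakk> \<Longrightarrow> x \<sqsubseteq> x \<oplus> y"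
  by (rule le_plus1)

lemma le_plus2 [simp]: "\<lbrakk>x \<in> \<C>; y \<in> \<C>\<rbrakk> \<Longrightarrow> x \<sqsubseteq> y \<oplus> x"
  by (metis le_plus1 plus_comm)

lemma le_refl [simp]: "x \<in> \<C> \<Longrightarrow> x \<sqsubseteq> x"
  by (metis le_plus1 plus_zero zero_closed)

lemma zero_le [simp]: "x \<in> \<C> \<Longrightarrow> \<zero> \<sqsubseteq> x"
  by (simp add: le_iff)

lemma le_one [simp]: "x \<in> \<C> \<Longrightarrow> x \<sqsubseteq> \<one>"
  by (simp add: le_iff)

lemma neg_plus [simp]: "x \<in> \<C> \<Longrightarrow> \<sim> x \<oplus> x = \<one>"
  by (metis le_iff le_refl)

lemma plus_neg [simp]: "x \<in> \<C> \<Longrightarrow> x \<oplus> \<sim> x = \<one>"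
  by (metis neg_plus neg_closed neg_neg)

text \<open>This is the Lukasiewicz axiom read as commutativity of the join:
  \<open>(x \<ominus> y) \<oplus> y\<close> is the least upper bound of \<open>x\<close> and
  \<open>y\<close>.\<close>

lemma minus_plus_comm: "\<lbrakk>x \<in> \<C>; y \<in> \<C>\<rbrakk> \<Longrightarrow> (x \<ominus> y) \<oplus> y = (y \<ominus> x) \<oplus> x"
  using lukasiewicz by (simp add: minus_eq)

lemma minus_plus_cancel: "\<lbrakk>x \<in> \<C>; y \<in> \<C>; y \<sqsubseteq> x\<rbrakk> \<Longrightarrow> (x \<ominus> y) \<oplus> y = x"
  using minus_plus_comm[of x y] by (simp add: mv_le_def)

lemma le_antisym: "\<lbrakk>x \<sqsubseteq> y; y \<sqsubseteq> x; x \<in> \<C>; y \<in> \<C>\<rbrakk> \<Longrightarrow> x = y"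
  by (metis minus_plus_cancel mv_le_def zero_plus)

text \<open>The order is divisibility for \<open>\<oplus>\<close>: here \<open>z\<close> equals
  \<open>(z \<ominus> y) \<oplus> (y \<ominus> x) \<oplus> x\<close>, which lies above
  \<open>x\<close>.\<close>

lemma le_trans [trans]: "\<lbrakk>x \<sqsubseteq> y; y \<sqsubseteq> z; x \<in> \<C>; y \<in> \<C>; z \<in> \<C>\<rbrakk> \<Longrightarrow> x \<sqsubseteq> z"
  using minus_plus_cancel[of y x] minus_plus_cancel[of z y]
    le_plus2[of x "(z \<ominus> y) \<oplus> (y \<ominus> x)"]
  by (simp add: plus_assoc)

lemma le_zero_iff [simp]: "x \<in> \<C> \<Longrightarrow> x \<sqsubseteq> \<zero> \<longleftrightarrow> x = \<zero>"
  using le_antisym zero_le zero_closed le_refl by metis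

lemma one_le_iff: "x \<in> \<C> \<Longrightarrow> \<one> \<sqsubseteq> x \<longleftrightarrow> x = \<one>"
  by (simp add: le_iff)

text \<open>Residuation. By associativity both sides say that
  \<open>\<sim> x \<oplus> y \<oplus> z\<close> is the unit.\<close>

lemma minus_le_iff:
  "\<lbrakk>x \<in> \<C>; y \<in> \<C>; z \<in> \<C>\<rbrakk> \<Longrightarrow> x \<ominus> y \<sqsubseteq> z \<longleftrightarrow> x \<sqsubseteq> y \<oplus> z"
  by (simp add: le_iff minus_eq plus_assoc)

lemma minus_le: "\<lbrakk>x \<in> \<C>; y \<in> \<C>\<rbrakk> \<Longrightarrow> x \<ominus> y \<sqsubseteq> x"
  by (simp add: minus_le_iff)

lemma le_plus_minus: "\<lbrakk>x \<in> \<C>; y \<in> \<C>\<rbrakk> \<Longrightarrow> x \<sqsubseteq> y \<oplus> (x \<ominus> y)"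
  by (simp flip: minus_le_iff)

lemma minus_self [simp]: "x \<in> \<C> \<Longrightarrow> x \<ominus> x = \<zero>"
  by (metis le_refl mv_le_def)

lemma neg_le_iff: "\<lbrakk>x \<in> \<C>; y \<in> \<C>\<rbrakk> \<Longrightarrow> \<sim> x \<sqsubseteq> \<sim> y \<longleftrightarrow> y \<sqsubseteq> x"
  by (simp add: le_iff plus_comm)

lemma le_neg_comm: "\<lbrakk>x \<in> \<C>; y \<in> \<C>\<rbrakk> \<Longrightarrow> x \<sqsubseteq> \<sim> y \<longleftrightarrow> y \<sqsubseteq> \<sim> x"
  by (metis neg_le_iff neg_neg neg_closed)

lemma neg_minus_neg: "\<lbrakk>x \<in> \<C>; y \<in> \<C>\<rbrakk> \<Longrightarrow> \<sim> x \<ominus> \<sim> y = y \<ominus> x"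
  by (simp add: minus_eq plus_comm)

lemma plus_mono:
  assumes "x \<sqsubseteq> x'" "y \<sqsubseteq> y'" "x \<in> \<C>" "x' \<in> \<C>" "y \<in> \<C>" "y' \<in> \<C>"
  shows "x \<oplus> y \<sqsubseteq> x' \<oplus> y'"
proof -
  have "x' \<oplus> y' = (x \<oplus> y) \<oplus> ((x' \<ominus> x) \<oplus> (y' \<ominus> y))"
  proof -
    have "x' \<oplus> y' = ((x' \<ominus> x) \<oplus> x) \<oplus> ((y' \<ominus> y) \<oplus> y)"
      using assms by (simp add: minus_plus_cancel)
    also have "\<dots> = (x \<oplus> y) \<oplus> ((x' \<ominus> x) \<oplus> (y' \<ominus> y))"
      using assms by (simp add: plus_ac)
    finally show ?thesis .
  qed
  then show ?thesis using assms by simp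
qed

text \<open>In \<open>[0,1]\<close> this says that x + y \<le> 1, so that \<open>\<oplus>\<close> is
  not truncated. On such pairs \<open>\<oplus>\<close> behaves like addition in an ordered group, in
  particular it is cancellative.\<close>

definition addable :: "'a \<Rightarrow> 'a \<Rightarrow> bool" where "addable x y \<longleftrightarrow> x \<sqsubseteq> \<sim> y"

lemma addable_comm: "\<lbrakk>x \<in> \<C>; y \<in> \<C>\<rbrakk> \<Longrightarrow> addable x y \<longleftrightarrow> addable y x"
  by (simp add: addable_def le_neg_comm)

text \<open>Since \<open>y\<close> lies below \<open>\<sim> x\<close>, the join of
  \<open>\<sim> x\<close> and \<open>y\<close> is \<open>\<sim> x\<close>; negating this equation
  gives the claim.\<close>

lemma plus_minus_cancel:
  assumes "addable x y" "x \<in> \<C>" "y \<in> \<C>"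
  shows "(x \<oplus> y) \<ominus> y = x"
proof -
  have "(\<sim> x \<ominus> y) \<oplus> y = \<sim> x"
    using assms by (simp add: minus_plus_cancel le_neg_comm addable_def)
  then show ?thesis using assms by (simp add: minus_eq)
qed

lemma addable_cancel:
  "\<lbrakk>x \<oplus> z = y \<oplus> z; addable x z; addable y z; x \<in> \<C>; y \<in> \<C>; z \<in> \<C>\<rbrakk> \<Longrightarrow> x = y"
  by (rule trans[OF sym[OF plus_minus_cancel[of x z]]]) (simp_all add: plus_minus_cancel)

lemma addable_mono:
  "\<lbrakk>addable x y; x' \<sqsubseteq> x; y' \<sqsubseteq> y; x \<in> \<C>; y \<in> \<C>; x' \<in> \<C>; y' \<in> \<C>\<rbrakk> \<Longrightarrow> addable x' y'"
  unfolding addable_def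
  using neg_le_iff[of y y'] le_trans[of x' x "\<sim> y"] le_trans[of x' "\<sim> y" "\<sim> y'"] by simp

lemma addable_minus: "\<lbrakk>x \<in> \<C>; y \<in> \<C>\<rbrakk> \<Longrightarrow> addable (x \<ominus> y) y"
  by (simp add: addable_def minus_le_iff)

text \<open>By residuation \<open>z\<close> lies below
  \<open>\<sim> (x \<oplus> y) = \<sim> x \<ominus> y\<close>; adding \<open>y\<close> brings this
  back to \<open>\<sim> x\<close>.\<close>

lemma addable_assoc:
  assumes "addable x y" "addable (x \<oplus> y) z" and C: "x \<in> \<C>" "y \<in> \<C>" "z \<in> \<C>"
  shows "addable x (y \<oplus> z)"
proof -
  have "z \<sqsubseteq> \<sim> x \<ominus> y"
    using assms by (simp add: addable_def minus_eq le_neg_comm)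
  then have "z \<oplus> y \<sqsubseteq> (\<sim> x \<ominus> y) \<oplus> y"
    using C by (simp add: plus_mono)
  also have "\<dots> = \<sim> x"
    using assms by (simp add: minus_plus_cancel le_neg_comm addable_def)
  finally show ?thesis
    using C by (simp add: addable_def le_neg_comm plus_comm)
qed

text \<open>Partial addition is associative in the strong sense: one bracketing is untruncated iff
  the other is. The converse is \<open>addable_assoc\<close> with \<open>x\<close> and
  \<open>z\<close> exchanged.\<close>

lemma addable_assoc_iff:
  assumes C: "x \<in> \<C>" "y \<in> \<C>" "z \<in> \<C>"
  shows "addable x y \<and> addable (x \<oplus> y) z \<longleftrightarrow> addable y z \<and> addable x (y \<oplus> z)"
proof -
  have *: "addable v w" if "addable (u \<oplus> v) w" "u \<in> \<C>" "v \<in> \<C>" "w \<in> \<C>" for u v w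
    using addable_mono[of "u \<oplus> v" w v w] that by simp
  have "addable (x \<oplus> y) z" "addable x y" if "addable y z" "addable x (y \<oplus> z)"
    using that addable_assoc[of z y x] *[of z y x] C
    by (auto simp: addable_comm plus_comm)
  then show ?thesis using addable_assoc *[of x y z] C by blast
qed

lemma le_addable:
  assumes "x \<sqsubseteq> y" "x \<in> \<C>" "y \<in> \<C>"
  obtains d where "d \<in> \<C>" "addable d x" "y = d \<oplus> x"
  using assms minus_plus_cancel[of y x] addable_minus[of y x] minus_closed by metis

text \<open>Disjointness, expressed through common lower bounds so that no lattice meet has to be
  constructed.\<close>

definition meet_zero :: "'a \<Rightarrow> 'a \<Rightarrow> bool" where
  "meet_zero x y \<longleftrightarrow> (\<forall>z\<in>\<C>. z \<sqsubseteq> x \<longrightarrow> z \<sqsubseteq> y \<longrightarrow> z = \<zero>)"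

text \<open>Split a common lower bound \<open>z\<close> off both differences, leaving
  \<open>u\<close> and \<open>v\<close>. Both expressions for the join of \<open>x\<close> and
  \<open>y\<close> then end in \<open>z\<close>, and cancelling it gives
  \<open>y \<oplus> u = x \<oplus> v\<close>, which is above \<open>x\<close>. Hence already
  \<open>u\<close> is above \<open>x \<ominus> y = u \<oplus> z\<close>, and \<open>z\<close>
  vanishes.\<close>

lemma meet_zero_minus:
  assumes C: "x \<in> \<C>" "y \<in> \<C>"
  shows "meet_zero (x \<ominus> y) (y \<ominus> x)"
  unfolding meet_zero_def
proof (intro ballI impI)
  fix z assume z: "z \<in> \<C>" "z \<sqsubseteq> x \<ominus> y" "z \<sqsubseteq> y \<ominus> x"
  obtain u where u: "u \<in> \<C>" "addable u z" "x \<ominus> y = u \<oplus> z"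
    using le_addable z C by (metis minus_closed)
  obtain v where v: "v \<in> \<C>" "addable v z" "y \<ominus> x = v \<oplus> z"
    using le_addable z C by (metis minus_closed)
  have s: "addable (u \<oplus> z) y" "addable (v \<oplus> z) x"
    using addable_minus[of x y] addable_minus[of y x] C u v by simp_all
  have "addable y u" "addable (y \<oplus> u) z"
    using addable_assoc_iff[of y u z] s u z C by (auto simp: addable_comm)
  moreover have "addable x v" "addable (x \<oplus> v) z"
    using addable_assoc_iff[of x v z] s v z C by (auto simp: addable_comm)
  moreover have eq: "(y \<oplus> u) \<oplus> z = (x \<oplus> v) \<oplus> z"
    using minus_plus_comm[of x y] u v z C by (simp add: plus_ac)
  ultimately have w: "y \<oplus> u = x \<oplus> v"
    using u v z C by (intro addable_cancel[of "y \<oplus> u" z "x \<oplus> v"]) auto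
  have "u \<oplus> z \<sqsubseteq> u"
    using minus_le_iff[of x y u] w u v C by simp
  then have "u \<oplus> z = u"
    using u z by (intro le_antisym) auto
  then show "z = \<zero>"
    using addable_cancel[of z u \<zero>] u z addable_comm[of u z] addable_comm[of \<zero> u]
    by (simp add: plus_comm) (simp add: addable_def)
qed

text \<open>By residuation \<open>z \<ominus> a\<close> is below \<open>a'\<close> as well as below
  \<open>b\<close>, so it is zero; thus \<open>z\<close> is below \<open>a\<close> and
  \<open>b\<close>.\<close>

lemma meet_zero_plus:
  assumes "meet_zero a b" "meet_zero a' b" "a \<in> \<C>" "a' \<in> \<C>" "b \<in> \<C>"
  shows "meet_zero (a \<oplus> a') b"
  unfolding meet_zero_def
proof (intro ballI impI)
  fix z assume z: "z \<in> \<C>" "z \<sqsubseteq> a \<oplus> a'" "z \<sqsubseteq> b"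
  have "z \<ominus> a \<sqsubseteq> a'"
    using z assms by (simp add: minus_le_iff)
  moreover have "z \<ominus> a \<sqsubseteq> b"
    by (rule le_trans[OF minus_le]) (use z assms in simp_all)
  ultimately have "z \<ominus> a = \<zero>"
    using assms(2) minus_closed[of z a] z assms(3) by (simp add: meet_zero_def)
  then have "z \<sqsubseteq> a"
    by (simp add: mv_le_def)
  then show "z = \<zero>"
    using z assms(1) by (simp add: meet_zero_def)
qed

lemma meet_zero_multiple:
  assumes "meet_zero a b" "a \<in> \<C>" "b \<in> \<C>"
  shows "meet_zero (mv_multiple A n a) b"
proof (induction n)
  case 0
  show ?case by (simp add: meet_zero_def)
next
  case (Suc n)
  then show ?case using assms by (simp add: meet_zero_plus)
qed

end

section \<open>Ideals and quotients\<close>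

context mv_algebra
begin

lemma multiple_add:
  "a \<in> \<C> \<Longrightarrow> mv_multiple A (m + n) a = mv_multiple A m a \<oplus> mv_multiple A n a"
  by (induction n) (simp_all add: plus_assoc)

text \<open>For an ideal \<open>I\<close> this is the ideal generated by \<open>I\<close> and
  \<open>a\<close>.\<close>

definition ideal_adjoin :: "'a set \<Rightarrow> 'a \<Rightarrow> 'a set" where
  "ideal_adjoin I a = {z \<in> \<C>. \<exists>m\<in>I. \<exists>k. z \<sqsubseteq> m \<oplus> mv_multiple A k a}"

lemma ideal_adjoin:
  assumes I: "mv_ideal A I" and a: "a \<in> \<C>"
  shows "mv_ideal A (ideal_adjoin I a)" "I \<subseteq> ideal_adjoin I a" "a \<in> ideal_adjoin I a"
proof -
  have IC: "m \<in> \<C>" if "m \<in> I" for m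
    using that I by (auto simp: mv_ideal_def)
  have z: "\<zero> \<in> I"
    using I by (simp add: mv_ideal_def)
  show "I \<subseteq> ideal_adjoin I a"
  proof
    fix m assume "m \<in> I"
    moreover from this have "m \<sqsubseteq> m \<oplus> mv_multiple A 0 a"
      by (simp add: IC)
    ultimately show "m \<in> ideal_adjoin I a"
      unfolding ideal_adjoin_def using IC by blast
  qed
  then have "\<zero> \<in> ideal_adjoin I a"
    using z by blast
  moreover have "a \<sqsubseteq> \<zero> \<oplus> mv_multiple A 1 a"
    using a by simp
  then show "a \<in> ideal_adjoin I a"
    unfolding ideal_adjoin_def using z a by blast
  moreover have "x \<oplus> y \<in> ideal_adjoin I a"
    if xy: "x \<in> ideal_adjoin I a" "y \<in> ideal_adjoin I a" for x y
  proof -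
    obtain m k where x: "x \<in> \<C>" "m \<in> I" "x \<sqsubseteq> m \<oplus> mv_multiple A k a"
      using xy by (auto simp: ideal_adjoin_def)
    obtain n l where y: "y \<in> \<C>" "n \<in> I" "y \<sqsubseteq> n \<oplus> mv_multiple A l a"
      using xy by (auto simp: ideal_adjoin_def)
    have "x \<oplus> y \<sqsubseteq> (m \<oplus> mv_multiple A k a) \<oplus> (n \<oplus> mv_multiple A l a)"
      using x y a IC by (intro plus_mono) auto
    also have "(m \<oplus> mv_multiple A k a) \<oplus> (n \<oplus> mv_multiple A l a)
        = (m \<oplus> n) \<oplus> mv_multiple A (k + l) a"
      using x y a IC by (simp add: multiple_add plus_ac)
    finally have "x \<oplus> y \<sqsubseteq> (m \<oplus> n) \<oplus> mv_multiple A (k + l) a" .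
    moreover have "m \<oplus> n \<in> I"
      using x y I by (simp add: mv_ideal_def)
    ultimately show ?thesis
      using x y by (auto simp: ideal_adjoin_def)
  qed
  moreover have "y \<in> ideal_adjoin I a"
    if x: "x \<in> ideal_adjoin I a" and y: "y \<in> \<C>" "y \<sqsubseteq> x" for x y
  proof -
    obtain m k where "x \<in> \<C>" "m \<in> I" "x \<sqsubseteq> m \<oplus> mv_multiple A k a"
      using x by (auto simp: ideal_adjoin_def)
    moreover from this have "y \<sqsubseteq> m \<oplus> mv_multiple A k a"
      using y a IC by (auto intro: le_trans[of y x])
    ultimately show ?thesis
      using y by (auto simp: ideal_adjoin_def)
  qed
  ultimately show "mv_ideal A (ideal_adjoin I a)"
    unfolding mv_ideal_def by (auto simp: ideal_adjoin_def)
qed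

section \<open>Maximal ideals\<close>

lemma ideal_zero: "mv_ideal A {\<zero>}"
  by (simp add: mv_ideal_def)

lemma ideal_proper_iff: "mv_ideal A I \<Longrightarrow> I \<noteq> \<C> \<longleftrightarrow> \<one> \<notin> I"
  using closed(3)[OF closed(1)] le_one by (auto simp: mv_ideal_def)

text \<open>Zorn's lemma, with properness expressed as \<open>\<one> \<notin> J\<close>, a condition
  that passes to unions of chains.\<close>

lemma maximal_ideal_exists:
  assumes I: "mv_ideal A I" "I \<noteq> \<C>"
  obtains M where "M \<in> maximal_ideals A" "I \<subseteq> M"
proof -
  define P where "P = {J. mv_ideal A J \<and> I \<subseteq> J \<and> \<one> \<notin> J}"
  have "\<exists>M\<in>P. \<forall>J\<in>P. M \<subseteq> J \<longrightarrow> J = M"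
  proof (rule subset_Zorn_nonempty)
    show "P \<noteq> {}"
      using I ideal_proper_iff by (auto simp: P_def)
    fix c assume c: "c \<noteq> {}" "subset.chain P c"
    have cP: "J \<in> P" if "J \<in> c" for J
      using that c by (auto simp: subset_chain_def)
    have "x \<oplus> y \<in> \<Union>c" if xy: "x \<in> \<Union>c" "y \<in> \<Union>c" for x y
    proof -
      obtain J K where "J \<in> c" "x \<in> J" "K \<in> c" "y \<in> K"
        using xy by blast
      moreover have "J \<subseteq> K \<or> K \<subseteq> J"
        using c calculation by (simp add: subset_chain_def)
      ultimately obtain J where "J \<in> c" "x \<in> J" "y \<in> J"
        by blast
      then show ?thesis
        using cP[of J] by (auto simp: P_def mv_ideal_def)
    qed
    moreover have "\<Union>c \<subseteq> \<C>"
      using cP by (simp add: P_def mv_ideal_def Union_least)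
    moreover have "\<zero> \<in> \<Union>c"
      using cP c by (auto simp: P_def mv_ideal_def)
    moreover have "y \<in> \<Union>c" if xy: "x \<in> \<Union>c" "y \<in> \<C>" "y \<sqsubseteq> x" for x y
    proof -
      obtain J where J: "J \<in> c" "x \<in> J"
        using xy by blast
      then have "y \<in> J"
        using cP[of J] xy by (simp add: P_def mv_ideal_def)
      then show ?thesis
        using J by blast
    qed
    ultimately have "mv_ideal A (\<Union>c)"
      by (simp only: mv_ideal_def) blast
    then show "\<Union>c \<in> P"
      using c cP unfolding P_def by blast
  qed
  then obtain M where M: "M \<in> P" "\<And>J. J \<in> P \<Longrightarrow> M \<subseteq> J \<Longrightarrow> J = M"
    by blast
  have "M \<in> maximal_ideals A"
    unfolding maximal_ideals_def using M ideal_proper_iff by (auto simp: P_def)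
  with M that show ?thesis by (auto simp: P_def)
qed

lemma maximal_idealD:
  assumes "M \<in> maximal_ideals A"
  shows "mv_ideal A M" "M \<subseteq> \<C>" "\<zero> \<in> M" "\<one> \<notin> M"
    "\<And>x y. x \<in> M \<Longrightarrow> y \<in> M \<Longrightarrow> x \<oplus> y \<in> M"
    "\<And>x y. x \<in> M \<Longrightarrow> y \<in> \<C> \<Longrightarrow> y \<sqsubseteq> x \<Longrightarrow> y \<in> M"
proof -
  show "\<one> \<notin> M"
    using assms ideal_proper_iff[of M] by (auto simp: maximal_ideals_def)
qed (use assms in \<open>auto simp: maximal_ideals_def mv_ideal_def\<close>)

text \<open>If \<open>y \<ominus> x\<close> is not in \<open>M\<close>, some \<open>m\<close> in
  \<open>M\<close> and a multiple of \<open>y \<ominus> x\<close> add up to the unit. Then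
  \<open>(x \<ominus> y) \<ominus> m\<close> lies below that multiple, which is disjoint from
  \<open>x \<ominus> y\<close>; so it vanishes and \<open>x \<ominus> y\<close> lies below
  \<open>m\<close>.\<close>

lemma maximal_ideal_prime:
  assumes M: "M \<in> maximal_ideals A" and C: "x \<in> \<C>" "y \<in> \<C>"
  shows "x \<ominus> y \<in> M \<or> y \<ominus> x \<in> M"
proof (rule disjCI)
  let ?v = "x \<ominus> y" and ?w = "y \<ominus> x"
  note MD = maximal_idealD[OF M]
  assume w: "?w \<notin> M"
  have "ideal_adjoin M ?w = \<C>"
    using M ideal_adjoin[OF MD(1), of ?w] w C unfolding maximal_ideals_def by auto
  then obtain m k where m: "m \<in> M" "\<one> \<sqsubseteq> m \<oplus> mv_multiple A k ?w"
    using closed(1) closed(3) unfolding ideal_adjoin_def by blast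
  have mC: "m \<in> \<C>"
    using m MD by auto
  have "?v \<sqsubseteq> m \<oplus> mv_multiple A k ?w"
    using m mC C by (simp add: one_le_iff)
  then have "?v \<ominus> m \<sqsubseteq> mv_multiple A k ?w"
    using mC C by (simp add: minus_le_iff)
  moreover have "?v \<ominus> m \<sqsubseteq> ?v"
    using mC C by (simp add: minus_le)
  moreover have "meet_zero (mv_multiple A k ?w) ?v"
    using C by (simp add: meet_zero_multiple meet_zero_minus)
  ultimately have "?v \<ominus> m = \<zero>"
    using mC C unfolding meet_zero_def by simp
  then show "?v \<in> M"
    using MD(6)[OF m(1), of ?v] C by (simp add: mv_le_def)
qed

lemma infinitesimal_avoid:
  assumes a: "a \<in> \<C>" and "\<not> infinitesimal A a"
  obtains M where "M \<in> maximal_ideals A" "a \<notin> M"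
proof -
  obtain n where n: "\<not> mv_multiple A n a \<sqsubseteq> \<sim> a"
    using assms by (auto simp: infinitesimal_def)
  let ?b = "mv_multiple A n a"
  let ?y = "\<sim> a \<ominus> ?b" and ?w = "?b \<ominus> \<sim> a"
  let ?I = "ideal_adjoin {\<zero>} ?y"
  have I: "mv_ideal A ?I" "?y \<in> ?I"
    using ideal_adjoin[OF ideal_zero, of ?y] a by auto
  have "\<one> \<notin> ?I"
  proof
    assume "\<one> \<in> ?I"
    then obtain k where "mv_multiple A k ?y = \<one>"
      using a by (auto simp: ideal_adjoin_def one_le_iff)
    \<comment> \<open>An element disjoint from the unit is zero, but \<open>?w\<close> is nonzero by
      the choice of \<open>n\<close>.\<close>
    moreover have "meet_zero (mv_multiple A k ?y) ?w"
      using a by (simp add: meet_zero_multiple meet_zero_minus)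
    ultimately have "?w = \<zero>"
      using a by (simp add: meet_zero_def)
    with n show False by (simp add: mv_le_def)
  qed
  then obtain M where M: "M \<in> maximal_ideals A" "?I \<subseteq> M"
    using maximal_ideal_exists I(1) ideal_proper_iff by metis
  note MD = maximal_idealD[OF M(1)]
  have "a \<notin> M"
  proof
    assume aM: "a \<in> M"
    have "?b \<in> M"
      by (induction n) (use MD aM in auto)
    \<comment> \<open>\<open>?y \<oplus> ?b\<close> lies above \<open>\<sim> a\<close>, so adding
      \<open>a\<close> reaches the unit and contradicts properness.\<close>
    then have "(?y \<oplus> ?b) \<oplus> a \<in> M"
      using MD(5) aM M I(2) by blast
    moreover have "(?y \<oplus> ?b) \<oplus> a = \<one>"
    proof -
      have "\<sim> a \<oplus> a \<sqsubseteq> (?y \<oplus> ?b) \<oplus> a"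
        using a le_plus_minus[of "\<sim> a" ?b] by (intro plus_mono) (simp_all add: plus_comm)
      then show ?thesis using a by (simp add: one_le_iff)
    qed
    ultimately show False using MD(4) by simp
  qed
  with that M show ?thesis by blast
qed

text \<open>Chosen representatives, rather than classes, keep the quotient on the type of \<open>A\<close>.\<close>

definition cong_mod :: "'a set \<Rightarrow> 'a \<Rightarrow> 'a \<Rightarrow> bool" where
  "cong_mod M x y \<longleftrightarrow> x \<ominus> y \<in> M \<and> y \<ominus> x \<in> M"

definition class_rep :: "'a set \<Rightarrow> 'a \<Rightarrow> 'a" where
  "class_rep M x = (SOME y. y \<in> \<C> \<and> cong_mod M x y)"

definition quotient :: "'a set \<Rightarrow> 'a mv_structure" where
  "quotient M = \<lparr>mv_carrier = class_rep M ` \<C>, mv_plus = (\<lambda>x y. class_rep M (x \<oplus> y)),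
    mv_neg = (\<lambda>x. class_rep M (\<sim> x)), mv_zero = class_rep M \<zero>\<rparr>"

end

section \<open>Congruence modulo an ideal and the quotient algebra\<close>

locale mv_ideal_quotient = mv_algebra A for A :: "('a, 'b) mv_structure_scheme" +
  fixes M :: "'a set"
  assumes ideal: "mv_ideal A M"
begin

lemma ideal_mono: "\<lbrakk>x \<sqsubseteq> y; y \<in> M; x \<in> \<C>\<rbrakk> \<Longrightarrow> x \<in> M"
  using ideal by (auto simp: mv_ideal_def)

lemma cong_refl [simp]: "x \<in> \<C> \<Longrightarrow> cong_mod M x x"
  using ideal by (simp add: cong_mod_def mv_ideal_def)

lemma cong_sym: "cong_mod M x y \<Longrightarrow> cong_mod M y x"
  by (simp add: cong_mod_def)

text \<open>The triangle inequality: \<open>x \<ominus> z\<close> lies below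
  \<open>(y \<ominus> z) \<oplus> (x \<ominus> y)\<close>.\<close>

lemma minus_trans_in_ideal:
  assumes "x \<ominus> y \<in> M" "y \<ominus> z \<in> M" and C: "x \<in> \<C>" "y \<in> \<C>" "z \<in> \<C>"
  shows "x \<ominus> z \<in> M"
proof (rule ideal_mono)
  have "x \<sqsubseteq> y \<oplus> (x \<ominus> y)"
    using C by (simp add: le_plus_minus)
  also have "y \<oplus> (x \<ominus> y) \<sqsubseteq> (z \<oplus> (y \<ominus> z)) \<oplus> (x \<ominus> y)"
    using C by (intro plus_mono) (simp_all add: le_plus_minus)
  finally show "x \<ominus> z \<sqsubseteq> (y \<ominus> z) \<oplus> (x \<ominus> y)"
    using C by (simp add: minus_le_iff plus_assoc)
qed (use assms ideal in \<open>auto simp: mv_ideal_def\<close>)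

lemma cong_trans:
  "\<lbrakk>cong_mod M x y; cong_mod M y z; x \<in> \<C>; y \<in> \<C>; z \<in> \<C>\<rbrakk> \<Longrightarrow> cong_mod M x z"
  unfolding cong_mod_def using minus_trans_in_ideal by blast

lemma plus_minus_plus_in_ideal:
  assumes "x \<ominus> y \<in> M" and C: "x \<in> \<C>" "y \<in> \<C>" "z \<in> \<C>"
  shows "(x \<oplus> z) \<ominus> (y \<oplus> z) \<in> M"
proof (rule ideal_mono)
  have "x \<oplus> z \<sqsubseteq> (y \<oplus> (x \<ominus> y)) \<oplus> z"
    using C by (intro plus_mono) (simp_all add: le_plus_minus)
  then show "(x \<oplus> z) \<ominus> (y \<oplus> z) \<sqsubseteq> x \<ominus> y"
    using C by (simp add: minus_le_iff plus_ac)
qed (use assms in auto)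

lemma cong_plus_right:
  "\<lbrakk>cong_mod M x y; x \<in> \<C>; y \<in> \<C>; z \<in> \<C>\<rbrakk> \<Longrightarrow> cong_mod M (x \<oplus> z) (y \<oplus> z)"
  unfolding cong_mod_def using plus_minus_plus_in_ideal by blast

lemma cong_plus:
  assumes "cong_mod M x x'" "cong_mod M y y'" "x \<in> \<C>" "x' \<in> \<C>" "y \<in> \<C>" "y' \<in> \<C>"
  shows "cong_mod M (x \<oplus> y) (x' \<oplus> y')"
proof (rule cong_trans)
  show "cong_mod M (x \<oplus> y) (x' \<oplus> y)"
    using assms by (simp add: cong_plus_right)
  show "cong_mod M (x' \<oplus> y) (x' \<oplus> y')"
    using assms cong_plus_right[of y y' x'] by (simp add: plus_comm)
qed (use assms in auto)

lemma cong_neg: "\<lbrakk>cong_mod M x y; x \<in> \<C>; y \<in> \<C>\<rbrakk> \<Longrightarrow> cong_mod M (\<sim> x) (\<sim> y)"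
  by (simp add: cong_mod_def neg_minus_neg)

abbreviation rep where "rep \<equiv> class_rep M"

lemma rep: assumes "x \<in> \<C>" shows "rep x \<in> \<C>" "cong_mod M x (rep x)"
  using someI[of "\<lambda>y. y \<in> \<C> \<and> cong_mod M x y" x] assms by (auto simp: class_rep_def)

lemma rep_eq_iff:
  assumes C: "x \<in> \<C>" "y \<in> \<C>"
  shows "rep x = rep y \<longleftrightarrow> cong_mod M x y"
proof
  assume "rep x = rep y"
  then show "cong_mod M x y"
    using rep[OF C(1)] rep[OF C(2)] cong_trans[of x "rep x" y] cong_sym[of y] C by simp
next
  assume *: "cong_mod M x y"
  have "cong_mod M x z \<longleftrightarrow> cong_mod M y z" if "z \<in> \<C>" for z
    using that * C cong_trans cong_sym by blast
  \<comment> \<open>Equal predicates make \<open>SOME\<close> pick the same element, so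
    representatives depend only on the class.\<close>
  then have "(\<lambda>z. z \<in> \<C> \<and> cong_mod M x z) = (\<lambda>z. z \<in> \<C> \<and> cong_mod M y z)"
    by blast
  then show "rep x = rep y" by (simp add: class_rep_def)
qed

lemma rep_rep [simp]: "x \<in> \<C> \<Longrightarrow> rep (rep x) = rep x"
  using rep cong_sym by (simp add: rep_eq_iff)

lemma rep_plus:
  assumes "x \<in> \<C>" "y \<in> \<C>"
  shows "rep (rep x \<oplus> y) = rep (x \<oplus> y)" "rep (x \<oplus> rep y) = rep (x \<oplus> y)"
  using assms rep by (simp_all add: rep_eq_iff cong_plus cong_sym)

lemma rep_neg: "x \<in> \<C> \<Longrightarrow> rep (\<sim> (rep x)) = rep (\<sim> x)"
  using rep by (simp add: rep_eq_iff cong_neg cong_sym)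

lemma quotient_sel [simp]:
  "mv_carrier (quotient M) = rep ` \<C>"
  "mv_plus (quotient M) x y = rep (x \<oplus> y)"
  "mv_neg (quotient M) x = rep (\<sim> x)"
  "mv_zero (quotient M) = rep \<zero>"
  by (simp_all add: quotient_def)

lemma quotient_mv_algebra: "mv_algebra (quotient M)"
proof
  fix x y z
  assume "x \<in> mv_carrier (quotient M)" "y \<in> mv_carrier (quotient M)" "z \<in> mv_carrier (quotient M)"
  then obtain u v w where "u \<in> \<C>" "v \<in> \<C>" "w \<in> \<C>" "x = rep u" "y = rep v" "z = rep w"
    by auto
  then show "mv_plus (quotient M) (mv_plus (quotient M) x y) z
      = mv_plus (quotient M) x (mv_plus (quotient M) y z)"
    using rep by (simp add: rep_plus plus_assoc)
next
  fix x y assume "x \<in> mv_carrier (quotient M)" "y \<in> mv_carrier (quotient M)"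
  then obtain u v where uv: "u \<in> \<C>" "v \<in> \<C>" "x = rep u" "y = rep v"
    by auto
  show "mv_plus (quotient M) (mv_neg (quotient M) (mv_plus (quotient M) (mv_neg (quotient M) x) y)) y
      = mv_plus (quotient M) (mv_neg (quotient M) (mv_plus (quotient M) (mv_neg (quotient M) y) x)) x"
    using uv rep lukasiewicz[of u v] by (simp add: rep_plus rep_neg)
qed (auto simp: rep rep_plus rep_neg plus_comm)

lemma quotient_le_iff:
  assumes C: "x \<in> \<C>" "y \<in> \<C>"
  shows "mv_le (quotient M) (rep x) (rep y) \<longleftrightarrow> x \<ominus> y \<in> M"
proof -
  have "mv_le (quotient M) (rep x) (rep y) \<longleftrightarrow> rep (x \<ominus> y) = rep \<zero>"
    using C rep by (simp add: mv_le_def mv_minus_def mv_times_def rep_plus rep_neg)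
  also have "\<dots> \<longleftrightarrow> x \<ominus> y \<in> M"
    using C ideal zero_le[of "x \<ominus> y"]
    by (simp add: rep_eq_iff cong_mod_def minus_eq[of _ \<zero>] mv_ideal_def mv_le_def[of _ \<zero>])
  finally show ?thesis .
qed

end

section \<open>Chains and characters\<close>

text \<open>Turns the estimates below, proved by induction on the number of doublings, into exact
  identities.\<close>

lemma zero_if_halving:
  fixes d :: real
  assumes "\<And>n. \<bar>d\<bar> \<le> C / 2 ^ n"
  shows "d = 0"
proof -
  have "(\<lambda>n. C * (1/2) ^ n) \<longlonglongrightarrow> C * 0"
    by (intro tendsto_intros LIMSEQ_realpow_zero) auto
  then have "(\<lambda>n. C / 2 ^ n) \<longlonglongrightarrow> 0"
    by (simp add: power_divide)
  then have "\<bar>d\<bar> \<le> 0"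
    by (rule LIMSEQ_le_const) (use assms in auto)
  then show ?thesis by simp
qed

lemma halving_step:
  fixes d e :: real
  assumes "\<bar>e\<bar> \<le> C / 2 ^ n" "d = e / 2"
  shows "\<bar>d\<bar> \<le> C / 2 ^ Suc n"
  using divide_right_mono[OF assms(1), of 2] by (simp add: assms(2) mult.commute)

section \<open>The binary expansion on a chain\<close>

locale mv_chain = mv_algebra +
  assumes total: "\<lbrakk>x \<in> mv_carrier A; y \<in> mv_carrier A\<rbrakk> \<Longrightarrow> mv_le A x y \<or> mv_le A y x"
    and nontrivial: "mv_neg A (mv_zero A) \<noteq> mv_zero A"
begin

text \<open>On \<open>[0,1]\<close> this is the shift of binary digits, t to 2t or to 2t - 1. The
  midpoint counts as low and is sent to 1, so 1/2 is expanded as 0.0111...\<close>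

definition double :: "'a \<Rightarrow> 'a" where
  "double a = (if a \<sqsubseteq> \<sim> a then a \<oplus> a else a \<ominus> \<sim> a)"

definition digit :: "'a \<Rightarrow> real" where
  "digit a = (if a \<sqsubseteq> \<sim> a then 0 else 1)"

definition state :: "'a \<Rightarrow> real" where
  "state a = (\<Sum>i. digit ((double ^^ i) a) * (1/2) ^ Suc i)"

lemma digit_term_bounds:
  "0 \<le> digit x * (1/2) ^ Suc i" "digit x * (1/2) ^ Suc i \<le> (1/2) ^ Suc i"
  by (auto simp: digit_def)

lemma summable_state: "summable (\<lambda>i. digit ((double ^^ i) a) * (1/2) ^ Suc i)"
proof (rule summable_comparison_test')
  show "summable (\<lambda>i. (1/2::real) ^ Suc i)"
    using power_half_series sums_summable by blast
  show "norm (digit ((double ^^ i) a) * (1/2) ^ Suc i) \<le> (1/2) ^ Suc i" for i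
    using digit_term_bounds[of "(double ^^ i) a" i] by (simp add: abs_of_nonneg)
qed

lemma state_bounds: "0 \<le> state a" "state a \<le> 1"
proof -
  show "0 \<le> state a"
    unfolding state_def by (intro suminf_nonneg summable_state digit_term_bounds)
  have "state a \<le> (\<Sum>i. (1/2::real) ^ Suc i)"
    unfolding state_def
    by (intro suminf_le summable_state digit_term_bounds sums_summable[OF power_half_series])
  then show "state a \<le> 1"
    using power_half_series by (simp add: sums_iff)
qed

lemma state_rec: "state a = (digit a + state (double a)) / 2"
proof -
  have "(\<Sum>i. digit ((double ^^ Suc i) a) * (1/2) ^ Suc (Suc i)) = state a - digit a / 2"
    using suminf_split_head[OF summable_state[of a]] by (simp add: state_def)
  moreover have "(\<Sum>i. digit ((double ^^ Suc i) a) * (1/2) ^ Suc (Suc i)) = state (double a) / 2"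
    unfolding state_def
    by (subst suminf_divide[OF summable_state, symmetric])
      (simp add: funpow_Suc_right del: funpow.simps)
  ultimately show ?thesis by simp
qed

lemma state_low: "a \<sqsubseteq> \<sim> a \<Longrightarrow> state a = state (a \<oplus> a) / 2"
  using state_rec[of a] by (simp add: digit_def double_def)

lemma state_high: "\<not> a \<sqsubseteq> \<sim> a \<Longrightarrow> state a = (1 + state (a \<ominus> \<sim> a)) / 2"
  using state_rec[of a] by (simp add: digit_def double_def)

text \<open>The unit is a fixed point of \<open>double\<close> with digit 1, so its value s solves s
  = (1 + s) / 2.\<close>

lemma state_one: "state \<one> = 1"
  using state_high[of \<one>] nontrivial by (simp add: minus_eq)

lemma state_zero: "state \<zero> = 0"
  using state_low[of \<zero>] by simp

text \<open>Doubling commutes with negation: if \<open>a\<close> is low and \<open>\<sim> a\<close>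
  is high, they are doubled to \<open>a \<oplus> a\<close> and its negation, so the error for
  \<open>a\<close> is half the error there. The midpoint, where both are low, is computed
  exactly.\<close>

lemma state_neg_approx: "a \<in> \<C> \<Longrightarrow> \<bar>state (\<sim> a) + state a - 1\<bar> \<le> 1 / 2 ^ n"
proof (induction n arbitrary: a)
  case 0
  then show ?case
    using state_bounds[of a] state_bounds[of "\<sim> a"] by (simp add: abs_le_iff)
next
  case (Suc n)
  note a = \<open>a \<in> \<C>\<close>
  consider "a \<sqsubseteq> \<sim> a" "\<sim> a \<sqsubseteq> a" | "a \<sqsubseteq> \<sim> a" "\<not> \<sim> a \<sqsubseteq> a" | "\<not> a \<sqsubseteq> \<sim> a" "\<sim> a \<sqsubseteq> a"
    using total[of a "\<sim> a"] a by auto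
  then show ?case
  proof cases
    case 1
    then have eq: "\<sim> a = a"
      using a by (intro le_antisym) auto
    then have "a \<oplus> a = \<one>"
      using plus_neg[OF a] by simp
    then have "state a = 1 / 2"
      using state_low[of a] 1 state_one by simp
    then have "state (\<sim> a) + state a - 1 = 0" by (simp add: eq)
    then show ?thesis by simp
  next
    case 2
    have "state (\<sim> a) = (1 + state (\<sim> (a \<oplus> a))) / 2"
      using state_high[of "\<sim> a"] 2 a by (simp add: minus_eq)
    moreover have *: "\<bar>state (\<sim> (a \<oplus> a)) + state (a \<oplus> a) - 1\<bar> \<le> 1 / 2 ^ n"
      using Suc.IH[of "a \<oplus> a"] a by simp
    ultimately show ?thesis
      using state_low[OF 2(1)] by (intro halving_step[OF *]) (simp add: field_simps)
  next
    case 3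
    have "state (\<sim> a) = state (\<sim> a \<oplus> \<sim> a) / 2"
      using state_low[of "\<sim> a"] 3 a by simp
    moreover have *: "\<bar>state (\<sim> a \<oplus> \<sim> a) + state (a \<ominus> \<sim> a) - 1\<bar> \<le> 1 / 2 ^ n"
      using Suc.IH[of "a \<ominus> \<sim> a"] a by (simp add: minus_eq)
    ultimately show ?thesis
      using state_high[OF 3(1)] by (intro halving_step[OF *]) (simp add: field_simps)
  qed
qed

lemma state_neg: "a \<in> \<C> \<Longrightarrow> state (\<sim> a) = 1 - state a"
  using zero_if_halving[of "state (\<sim> a) + state a - 1" 1] state_neg_approx[of a] by simp

text \<open>The hypothesis makes the fourfold sum of \<open>a\<close>, \<open>b\<close>,
  \<open>a\<close>, \<open>b\<close> untruncated, and such a sum may be reordered and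
  rebracketed.\<close>

lemma double_plus_low:
  assumes C: "a \<in> \<C>" "b \<in> \<C>" and low: "addable (a \<oplus> b) (a \<oplus> b)"
  shows "addable (a \<oplus> a) (b \<oplus> b)"
proof -
  have ab: "addable a b"
    using addable_mono[OF low, of a b] C by simp
  have "addable a (b \<oplus> (a \<oplus> b))"
    using addable_assoc[OF ab low] C by simp
  then have *: "addable ((b \<oplus> b) \<oplus> a) a"
    using C by (simp add: addable_comm plus_ac)
  then have "addable (b \<oplus> b) a"
    using addable_mono[OF *, of "b \<oplus> b" a] C by simp
  then have "addable (b \<oplus> b) (a \<oplus> a)"
    using addable_assoc[OF _ *] C by simp
  then show ?thesis using C by (simp add: addable_comm)
qed

text \<open>In the enveloping ordered group \<open>z = 2(a + b) - 1\<close> and \<open>t = 1 - 2b\<close>.\<close>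

lemma double_plus_carry:
  assumes C: "a \<in> \<C>" "b \<in> \<C>" and ab: "addable a b" "a \<sqsubseteq> b"
    and b: "b \<sqsubseteq> \<sim> b" and high: "\<not> a \<oplus> b \<sqsubseteq> \<sim> (a \<oplus> b)"
  defines "z \<equiv> (a \<oplus> b) \<ominus> \<sim> (a \<oplus> b)" and "t \<equiv> \<sim> (b \<oplus> b)"
  shows "addable z t" "z \<oplus> t = a \<oplus> a"
proof -
  let ?c = "a \<oplus> b"
  \<comment> \<open>In the group \<open>e\<close> is b - a. Both \<open>2a + e\<close> and
    \<open>z + t + e\<close> equal a + b, the latter because \<open>t + e\<close> is
    \<open>\<sim> ?c\<close>; cancelling \<open>e\<close> gives the claim.\<close>
  define e where "e = b \<ominus> a"
  have zte: "z \<in> \<C>" "t \<in> \<C>" "e \<in> \<C>"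
    using C by (simp_all add: z_def t_def e_def)
  have e: "addable e a" "e \<oplus> a = b"
    using C ab by (simp_all add: e_def addable_minus minus_plus_cancel)
  have "\<sim> ?c \<sqsubseteq> ?c"
    using total[of ?c "\<sim> ?c"] high C by auto
  then have z: "addable z (\<sim> ?c)" "z \<oplus> \<sim> ?c = ?c"
    using C by (simp_all add: z_def addable_minus minus_plus_cancel)
  have "t = \<sim> b \<ominus> b"
    using C by (simp add: t_def minus_eq)
  then have t: "addable t b" "t \<oplus> b = \<sim> b"
    using C b by (simp_all add: addable_minus minus_plus_cancel)
  have "\<sim> ?c = \<sim> b \<ominus> a"
    using C by (simp add: minus_eq plus_comm)
  then have c: "addable (\<sim> ?c) a" "\<sim> ?c \<oplus> a = \<sim> b"
    using C ab addable_minus[of "\<sim> b" a]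
    by (simp_all add: minus_plus_cancel addable_def)
  have te: "addable t e" "addable (t \<oplus> e) a"
    using addable_assoc_iff[of t e a] t e zte C by auto
  have "(t \<oplus> e) \<oplus> a = \<sim> ?c \<oplus> a"
    using c(2) t(2) e(2) zte C by (simp add: plus_assoc)
  then have tec: "t \<oplus> e = \<sim> ?c"
    using addable_cancel[of "t \<oplus> e" a "\<sim> ?c"] te c zte C by simp
  have zt: "addable z t" "addable (z \<oplus> t) e"
    using addable_assoc_iff[of z t e] z te zte tec by auto
  show "addable z t" by fact
  have aa: "addable (a \<oplus> a) e"
    using addable_assoc_iff[of a a e] ab e zte C by (auto simp: addable_comm plus_comm)
  have "?c = (a \<oplus> a) \<oplus> e"
    using e(2) zte C by (metis plus_assoc plus_comm)
  moreover have "?c = (z \<oplus> t) \<oplus> e"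
    using z(2) tec zte by (simp add: plus_assoc)
  ultimately show "z \<oplus> t = a \<oplus> a"
    using addable_cancel[of "z \<oplus> t" e "a \<oplus> a"] zt aa zte C by simp
qed

text \<open>In the enveloping group this reads 2(a + b) - 1 = (2b - 1) + 2a. It follows by writing
  \<open>b\<close> as the untruncated sum of \<open>q\<close>, \<open>a\<close> and
  \<open>\<sim> (a \<oplus> b)\<close> and cancelling the last term from
  \<open>a \<oplus> b\<close>.\<close>

lemma double_plus_high:
  assumes C: "a \<in> \<C>" "b \<in> \<C>" and ab: "addable a b" and b: "\<not> b \<sqsubseteq> \<sim> b"
  defines "q \<equiv> b \<ominus> \<sim> b"
  shows "addable q (a \<oplus> a)" "(a \<oplus> b) \<ominus> \<sim> (a \<oplus> b) = q \<oplus> (a \<oplus> a)"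
proof -
  let ?c = "a \<oplus> b"
  have q: "q \<in> \<C>"
    using C by (simp add: q_def)
  have "\<sim> b \<sqsubseteq> b"
    using total[of b "\<sim> b"] b C by auto
  then have qb: "addable q (\<sim> b)" "q \<oplus> \<sim> b = b"
    using C by (simp_all add: q_def addable_minus minus_plus_cancel)
  have "\<sim> ?c = \<sim> b \<ominus> a"
    using C by (simp add: minus_eq plus_comm)
  then have c: "addable a (\<sim> ?c)" "a \<oplus> \<sim> ?c = \<sim> b"
    using C ab addable_minus[of "\<sim> b" a] plus_comm[of a "\<sim> b \<ominus> a"]
    by (simp_all add: minus_plus_cancel addable_def[of a b] addable_comm)
  have 1: "addable q a" "addable (q \<oplus> a) (\<sim> ?c)"
    using addable_assoc_iff[of q a "\<sim> ?c"] c qb q C by auto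
  have bq: "b = (q \<oplus> a) \<oplus> \<sim> ?c"
    using qb(2) c(2) q C by (simp add: plus_assoc)
  have "addable ((q \<oplus> a) \<oplus> \<sim> ?c) a"
    using ab C by (simp add: addable_comm flip: bq)
  from addable_assoc[OF 1(2) this] have "addable (q \<oplus> a) (a \<oplus> \<sim> ?c)"
    using q C by (simp add: plus_comm[of "\<sim> ?c" a])
  then have 2: "addable (q \<oplus> a) a" "addable ((q \<oplus> a) \<oplus> a) (\<sim> ?c)"
    using addable_assoc_iff[of "q \<oplus> a" a "\<sim> ?c"] c q C by auto
  show "addable q (a \<oplus> a)"
    using addable_assoc[OF 1(1) 2(1)] q C by simp
  have "?c = a \<oplus> ((q \<oplus> a) \<oplus> \<sim> ?c)"
    using bq by simp
  also have "\<dots> = ((q \<oplus> a) \<oplus> a) \<oplus> \<sim> ?c"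
    using q C by (simp add: plus_ac)
  finally have "?c \<ominus> \<sim> ?c = (((q \<oplus> a) \<oplus> a) \<oplus> \<sim> ?c) \<ominus> \<sim> ?c"
    by simp
  also have "\<dots> = (q \<oplus> a) \<oplus> a"
    using plus_minus_cancel[OF 2(2)] q C by simp
  finally show "?c \<ominus> \<sim> ?c = q \<oplus> (a \<oplus> a)"
    using q C by (simp add: plus_assoc)
qed

text \<open>Doubling turns an untruncated sum into another untruncated sum, possibly with its terms
  rearranged, so each step halves the error. The initial constant 2 comes from three values in
  \<open>[0,1]\<close>.\<close>

lemma state_plus_approx:
  "\<lbrakk>addable a b; a \<in> \<C>; b \<in> \<C>\<rbrakk> \<Longrightarrow> \<bar>state (a \<oplus> b) - state a - state b\<bar> \<le> 2 / 2 ^ n"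
proof (induction n arbitrary: a b)
  case 0
  then show ?case
    using state_bounds[of a] state_bounds[of b] state_bounds[of "a \<oplus> b"] by (simp add: abs_le_iff)
next
  case (Suc n)
  \<comment> \<open>By totality and symmetry \<open>a\<close> may be taken as the smaller summand;
    it is then low, and the cases concern only the first digits of \<open>b\<close> and of the
    sum.\<close>
  have *: "\<bar>state (a \<oplus> b) - state a - state b\<bar> \<le> 2 / 2 ^ Suc n"
    if ab: "addable a b" "a \<sqsubseteq> b" and C: "a \<in> \<C>" "b \<in> \<C>" for a b
  proof -
    let ?c = "a \<oplus> b"
    have bc: "?c \<sqsubseteq> \<sim> ?c \<Longrightarrow> b \<sqsubseteq> \<sim> b"
      using addable_mono[of ?c ?c b b] C by (simp add: addable_def)
    have aa: "a \<sqsubseteq> \<sim> a"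
      using addable_mono[OF ab(1), of a a] ab(2) C by (simp add: addable_def)
    consider "?c \<sqsubseteq> \<sim> ?c" "b \<sqsubseteq> \<sim> b" | "\<not> ?c \<sqsubseteq> \<sim> ?c" "b \<sqsubseteq> \<sim> b" | "\<not> ?c \<sqsubseteq> \<sim> ?c" "\<not> b \<sqsubseteq> \<sim> b"
      using bc by blast
    then show ?thesis
    proof cases
      case 1
      have "addable (a \<oplus> a) (b \<oplus> b)"
        using double_plus_low[of a b] 1 C by (simp add: addable_def)
      then have *: "\<bar>state ((a \<oplus> a) \<oplus> (b \<oplus> b)) - state (a \<oplus> a) - state (b \<oplus> b)\<bar> \<le> 2 / 2 ^ n"
        using Suc.IH C by simp
      moreover have "?c \<oplus> ?c = (a \<oplus> a) \<oplus> (b \<oplus> b)"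
        using C by (simp add: plus_ac)
      ultimately show ?thesis
        using state_low[OF 1(1)] state_low[OF 1(2)] state_low[OF aa]
        by (intro halving_step[OF *]) (simp add: field_simps)
    next
      case 2
      let ?z = "?c \<ominus> \<sim> ?c" and ?t = "\<sim> (b \<oplus> b)"
      note zt = double_plus_carry[OF C ab 2(2,1)]
      \<comment> \<open>With a carry the roles change: the sum handled by induction is 2a = (2(a +
        b) - 1) + (1 - 2b), and \<open>state_neg\<close> converts the value of
        \<open>?t\<close>.\<close>
      have *: "\<bar>state ?z + state ?t - state (?z \<oplus> ?t)\<bar> \<le> 2 / 2 ^ n"
        using Suc.IH[OF zt(1)] C by (simp add: abs_le_iff)
      moreover have "state ?t = 1 - state (b \<oplus> b)"
        using C by (simp add: state_neg)
      ultimately show ?thesis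
        using state_high[OF 2(1)] state_low[OF 2(2)] state_low[OF aa] zt(2)
        by (intro halving_step[OF *]) (simp add: field_simps)
    next
      case 3
      note q = double_plus_high[OF C ab(1) 3(2)]
      have *: "\<bar>state ((b \<ominus> \<sim> b) \<oplus> (a \<oplus> a)) - state (b \<ominus> \<sim> b) - state (a \<oplus> a)\<bar> \<le> 2 / 2 ^ n"
        using Suc.IH[OF q(1)] C by simp
      then show ?thesis
        using state_high[OF 3(1)] state_high[OF 3(2)] state_low[OF aa] q(2)
        by (intro halving_step[OF *]) (simp add: field_simps)
    qed
  qed
  show ?case
    using total[of a b] *[of a b] *[of b a] Suc.prems
    by (auto simp: addable_comm plus_comm algebra_simps)
qed

lemma state_plus:
  "\<lbrakk>addable a b; a \<in> \<C>; b \<in> \<C>\<rbrakk> \<Longrightarrow> state (a \<oplus> b) = state a + state b"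
  using zero_if_halving[of "state (a \<oplus> b) - state a - state b" 2] state_plus_approx[of a b] by simp

lemma state_mono:
  assumes "x \<sqsubseteq> y" "x \<in> \<C>" "y \<in> \<C>"
  shows "state x \<le> state y"
proof -
  obtain d where "d \<in> \<C>" "addable d x" "y = d \<oplus> x"
    using le_addable assms by blast
  then show ?thesis
    using assms state_plus[of d x] state_bounds(1)[of d] by simp
qed

text \<open>If the sum is truncated, then \<open>\<sim> b\<close> lies below \<open>a\<close> by
  totality, so the sum is the unit and monotonicity makes the two values add up to at least
  1.\<close>

lemma state_plus_min:
  assumes C: "a \<in> \<C>" "b \<in> \<C>"
  shows "state (a \<oplus> b) = min 1 (state a + state b)"
proof (cases "addable a b")
  case True
  then show ?thesis
    using state_plus[OF True C] state_bounds(2)[of "a \<oplus> b"] by simp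
next
  case False
  then have le: "\<sim> b \<sqsubseteq> a"
    using total[of a "\<sim> b"] C by (auto simp: addable_def)
  then have "a \<oplus> b = \<one>"
    using C by (simp add: le_iff plus_comm)
  moreover have "1 - state b \<le> state a"
    using state_mono[OF le] C by (simp add: state_neg)
  ultimately show ?thesis
    by (simp add: state_one min_def)
qed

end

section \<open>Characters and their kernels\<close>

context mv_algebra
begin

lemma mv_characters_iff:
  "h \<in> mv_characters A \<longleftrightarrow> h \<in> \<C> \<rightarrow>\<^sub>E {0..1} \<and> h \<zero> = 0 \<and> (\<forall>x\<in>\<C>. h (\<sim> x) = 1 - h x) \<and>
    (\<forall>x\<in>\<C>. \<forall>y\<in>\<C>. h (x \<oplus> y) = min 1 (h x + h y))"
  by (simp add: mv_characters_def mv_hom_def mv_unit_interval_def)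

lemma characterD:
  assumes "h \<in> mv_characters A"
  shows "h \<zero> = 0" "\<And>x. x \<in> \<C> \<Longrightarrow> h (\<sim> x) = 1 - h x"
    "\<And>x y. \<lbrakk>x \<in> \<C>; y \<in> \<C>\<rbrakk> \<Longrightarrow> h (x \<oplus> y) = min 1 (h x + h y)"
    "\<And>x. x \<in> \<C> \<Longrightarrow> 0 \<le> h x" "\<And>x. x \<in> \<C> \<Longrightarrow> h x \<le> 1"
    "\<And>x. x \<notin> \<C> \<Longrightarrow> h x = undefined"
  using assms by (auto simp: mv_characters_iff PiE_iff extensional_def)

lemma character_minus:
  assumes h: "h \<in> mv_characters A" and C: "x \<in> \<C>" "y \<in> \<C>"
  shows "h (x \<ominus> y) = max 0 (h x - h y)"
  using C by (simp add: minus_eq characterD[OF h])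

lemma character_multiple:
  assumes h: "h \<in> mv_characters A" and a: "a \<in> \<C>"
  shows "h (mv_multiple A n a) = min 1 (real n * h a)"
proof (induction n)
  case 0
  show ?case by (simp add: characterD(1)[OF h])
next
  case (Suc n)
  then show ?case
    using a characterD(4)[OF h a] by (auto simp: characterD(3)[OF h] min_def algebra_simps)
qed

lemma character_mono:
  assumes h: "h \<in> mv_characters A" and C: "x \<in> \<C>" "y \<in> \<C>" and le: "x \<sqsubseteq> y"
  shows "h x \<le> h y"
  using character_minus[OF h C] le characterD(1)[OF h] by (simp add: mv_le_def max_def split: if_splits)

text \<open>The reals are Archimedean: an ideal properly above the kernel contains some
  \<open>a\<close> with \<open>h a > 0\<close>, a large multiple of \<open>a\<close> has value 1,
  and its negation is in the kernel. The ideal contains both, hence the unit.\<close>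

lemma character_kernel_maximal:
  assumes h: "h \<in> mv_characters A"
  shows "character_kernel A h \<in> maximal_ideals A"
proof -
  note hD = characterD[OF h]
  let ?K = "character_kernel A h"
  have down: "y \<in> ?K" if "x \<in> ?K" "y \<in> \<C>" "y \<sqsubseteq> x" for x y
    using character_mono[OF h, of y x] hD(4)[of y] that by (simp add: character_kernel_def)
  have plus: "x \<oplus> y \<in> ?K" if "x \<in> ?K" "y \<in> ?K" for x y
    using that by (simp add: character_kernel_def hD(3))
  have "?K \<subseteq> \<C>" "\<zero> \<in> ?K"
    using hD(1) by (auto simp: character_kernel_def)
  then have K: "mv_ideal A ?K"
    unfolding mv_ideal_def using down plus by blast
  moreover have "\<one> \<notin> ?K"
    using hD(1) hD(2)[of \<zero>] by (simp add: character_kernel_def)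
  then have "?K \<noteq> \<C>"
    using ideal_proper_iff[OF K] by blast
  moreover have "I = \<C>" if I: "mv_ideal A I" "?K \<subseteq> I" "I \<noteq> ?K" for I
  proof -
    have IC: "I \<subseteq> \<C>" and Ip: "\<And>x y. x \<in> I \<Longrightarrow> y \<in> I \<Longrightarrow> x \<oplus> y \<in> I" and "\<zero> \<in> I"
      using I by (auto simp: mv_ideal_def)
    obtain a where a: "a \<in> I" "a \<notin> ?K"
      using I by blast
    then have aC: "a \<in> \<C>" and "0 < h a"
      using IC hD(4)[of a] by (auto simp: character_kernel_def less_le)
    then obtain n :: nat where "1 < real n * h a"
      using reals_Archimedean3 by blast
    then have "h (\<sim> (mv_multiple A n a)) = 0"
      using aC by (simp add: hD character_multiple[OF h])
    then have "\<sim> (mv_multiple A n a) \<in> ?K"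
      using aC by (simp add: character_kernel_def)
    then have "\<sim> (mv_multiple A n a) \<in> I"
      using I(2) by blast
    moreover have "mv_multiple A n a \<in> I"
      by (induction n) (use a Ip \<open>\<zero> \<in> I\<close> in auto)
    ultimately have "\<sim> (mv_multiple A n a) \<oplus> mv_multiple A n a \<in> I"
      by (rule Ip)
    then have "\<one> \<in> I"
      using aC by simp
    then show ?thesis
      using ideal_proper_iff[OF I(1)] by blast
  qed
  ultimately show ?thesis by (auto simp: maximal_ideals_def)
qed

lemma character_kernel_inj: "inj_on (character_kernel A) (mv_characters A)"
proof (rule inj_onI)
  fix g h assume gh: "g \<in> mv_characters A" "h \<in> mv_characters A"
    and eq: "character_kernel A g = character_kernel A h"
  note gD = characterD[OF gh(1)] and hD = characterD[OF gh(2)]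
  have same: "g a \<le> 1/2 \<longleftrightarrow> h a \<le> 1/2" if "a \<in> \<C>" for a
  proof -
    \<comment> \<open>A character \<open>k\<close> sends \<open>a \<ominus> \<sim> a\<close> to the
      positive part of 2 k(a) - 1.\<close>
    have "a \<ominus> \<sim> a \<in> character_kernel A k \<longleftrightarrow> k a \<le> 1/2" if "k \<in> mv_characters A" for k
      using that \<open>a \<in> \<C>\<close>
      by (simp add: character_kernel_def character_minus characterD(2)[OF that] max_def field_simps)
    then show ?thesis
      using eq gh by blast
  qed
  have "\<bar>g a - h a\<bar> \<le> 1 / 2 ^ n" if "a \<in> \<C>" for a n
    using that
  proof (induction n arbitrary: a)
    case 0
    then show ?case
      using gD(4,5)[of a] hD(4,5)[of a] by (simp add: abs_le_iff)
  next
    case (Suc n)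
    note a = \<open>a \<in> \<C>\<close>
    show ?case
    proof (cases "g a \<le> 1/2")
      case True
      then have "g (a \<oplus> a) = 2 * g a" "h (a \<oplus> a) = 2 * h a"
        using same[OF a] a by (simp_all add: gD hD)
      then show ?thesis
        using Suc.IH[of "a \<oplus> a"] a
        by (intro halving_step[of "g (a \<oplus> a) - h (a \<oplus> a)"]) (simp_all add: field_simps)
    next
      case False
      then have "g (a \<ominus> \<sim> a) = 2 * g a - 1" "h (a \<ominus> \<sim> a) = 2 * h a - 1"
        using same[OF a] a by (simp_all add: character_minus gh gD hD)
      then show ?thesis
        using Suc.IH[of "a \<ominus> \<sim> a"] a
        by (intro halving_step[of "g (a \<ominus> \<sim> a) - h (a \<ominus> \<sim> a)"]) (simp_all add: field_simps)
    qed
  qed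
  \<comment> \<open>Outside the carrier both characters are \<open>undefined\<close> by
    extensionality.\<close>
  then have "g a = h a" for a
    using zero_if_halving[of "g a - h a" 1] gD(6)[of a] hD(6)[of a] by (cases "a \<in> \<C>") auto
  then show "g = h" by blast
qed

text \<open>The character is \<open>state\<close> on the quotient by \<open>M\<close>, pulled back
  along the projection. Primeness makes the quotient a chain, and properness of \<open>M\<close>
  makes it nontrivial.\<close>

lemma maximal_ideal_character:
  assumes M: "M \<in> maximal_ideals A"
  obtains h where "h \<in> mv_characters A" "character_kernel A h = M"
proof -
  note MD = maximal_idealD[OF M]
  interpret Q: mv_ideal_quotient A M
    by unfold_locales (rule MD(1))
  have rep0: "Q.rep x = Q.rep \<zero> \<longleftrightarrow> x \<in> M" if "x \<in> \<C>" for x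
    using that MD(3) zero_le[OF that]
    by (simp add: Q.rep_eq_iff cong_mod_def minus_eq[of _ \<zero>] mv_le_def[of _ \<zero>])
  interpret QA: mv_algebra "quotient M"
    by (rule Q.quotient_mv_algebra)
  interpret C: mv_chain "quotient M"
  proof
    fix x y assume "x \<in> mv_carrier (quotient M)" "y \<in> mv_carrier (quotient M)"
    then show "mv_le (quotient M) x y \<or> mv_le (quotient M) y x"
      using maximal_ideal_prime[OF M] Q.quotient_le_iff by auto
  next
    have "Q.rep (\<sim> Q.rep \<zero>) \<noteq> Q.rep \<zero>"
      using rep0[of \<one>] MD(4) by (simp add: Q.rep_neg)
    then show "mv_neg (quotient M) (mv_zero (quotient M)) \<noteq> mv_zero (quotient M)"
      by simp
  qed
  define h where "h = (\<lambda>x\<in>\<C>. C.state (Q.rep x))"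
  have "h (\<sim> x) = 1 - h x" if "x \<in> \<C>" for x
    using that C.state_neg[of "Q.rep x"] by (simp add: h_def Q.rep_neg)
  moreover have "h (x \<oplus> y) = min 1 (h x + h y)" if "x \<in> \<C>" "y \<in> \<C>" for x y
    using that C.state_plus_min[of "Q.rep x" "Q.rep y"] Q.rep by (simp add: h_def Q.rep_plus)
  moreover have "h \<zero> = 0"
    using C.state_zero by (simp add: h_def)
  ultimately have h: "h \<in> mv_characters A"
    using C.state_bounds by (auto simp: mv_characters_iff h_def)
  have "h x = 0" if "x \<in> M" for x
  proof -
    have x: "x \<in> \<C>"
      using that MD(2) by blast
    then have "Q.rep x = Q.rep \<zero>"
      using rep0 that by blast
    then show ?thesis
      using C.state_zero x by (simp add: h_def)
  qed
  \<comment> \<open>One inclusion suffices: the kernel is a proper ideal and \<open>M\<close> is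
    maximal.\<close>
  then have "M \<subseteq> character_kernel A h"
    using MD(2) by (auto simp: character_kernel_def)
  moreover have "character_kernel A h \<in> maximal_ideals A"
    using h by (rule character_kernel_maximal)
  ultimately have "character_kernel A h = M"
    using M unfolding maximal_ideals_def by blast
  with h that show ?thesis by blast
qed

lemma character_kernel_bij:
  "bij_betw (character_kernel A) (mv_characters A) (maximal_ideals A)"
  unfolding bij_betw_def
  using character_kernel_inj character_kernel_maximal maximal_ideal_character by blast

lemma infinitesimal_iff:
  assumes a: "a \<in> \<C>"
  shows "infinitesimal A a \<longleftrightarrow> (\<forall>h\<in>mv_characters A. h a = 0)"
proof
  assume inf: "infinitesimal A a"
  show "\<forall>h\<in>mv_characters A. h a = 0"
  proof (rule ballI, rule ccontr)
    fix h assume h: "h \<in> mv_characters A" "h a \<noteq> 0"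
    note hD = characterD[OF h(1)]
    have "0 < h a"
      using hD(4)[OF a] h by simp
    \<comment> \<open>For this \<open>n\<close> the multiple has value 1, which exceeds
      \<open>h (\<sim> a) = 1 - h a\<close>.\<close>
    then obtain n :: nat where n: "1 < real n * h a"
      using reals_Archimedean3 by blast
    have "h (mv_multiple A n a) \<le> h (\<sim> a)"
      using inf a by (intro character_mono[OF h(1)]) (simp_all add: infinitesimal_def)
    then show False
      using n a \<open>0 < h a\<close> by (simp add: character_multiple[OF h(1)] hD)
  qed
next
  assume *: "\<forall>h\<in>mv_characters A. h a = 0"
  show "infinitesimal A a"
  proof (rule ccontr)
    assume "\<not> infinitesimal A a"
    then obtain M where "M \<in> maximal_ideals A" "a \<notin> M"
      using infinitesimal_avoid a by blast
    moreover from this obtain h where "h \<in> mv_characters A" "character_kernel A h = M"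
      using maximal_ideal_character by blast
    ultimately show False
      using * a by (auto simp: character_kernel_def)
  qed
qed

text \<open>With t = h(a), the difference of consecutive multiples has value min(1, (n+1)t) - min(1,
  nt), which vanishes exactly if t = 0 or nt \<ge> 1.\<close>

lemma quasiarchimedean_iff:
  assumes a: "a \<in> \<C>"
  shows "quasiarchimedean A a \<longleftrightarrow> (\<exists>n::nat. \<forall>h\<in>mv_characters A. h a = 0 \<or> 1 \<le> real n * h a)"
proof -
  have "h (mv_multiple A (n + 1) a \<ominus> mv_multiple A n a) = 0 \<longleftrightarrow> h a = 0 \<or> 1 \<le> real n * h a"
    if h: "h \<in> mv_characters A" for h and n :: nat
  proof -
    have "h (mv_multiple A (n + 1) a \<ominus> mv_multiple A n a)
        = max 0 (min 1 (real (n + 1) * h a) - min 1 (real n * h a))"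
      using a by (simp only: character_minus[OF h] character_multiple[OF h] multiple_closed)
    then show ?thesis
      using characterD(4)[OF h a] by (auto simp: min_def max_def algebra_simps)
  qed
  then show ?thesis
    using a unfolding quasiarchimedean_def by (simp add: infinitesimal_iff)
qed

end

section \<open>Topology of the spectra\<close>

context mv_algebra
begin

section \<open>Compactness of the character space\<close>

lemma character_domain: "mv_characters A \<subseteq> \<C> \<rightarrow>\<^sub>E {0..1}"
  by (rule subsetI) (simp add: mv_characters_iff)

lemma topspace_character_space: "topspace (character_space A) = mv_characters A"
  using character_domain by (auto simp: character_space_def)

lemma continuous_map_evaluation:
  assumes "x \<in> \<C>"
  shows "continuous_map (product_topology (\<lambda>_. top_of_set {0..1}) \<C>) euclideanreal (\<lambda>h. h x)"
  using continuous_map_product_projection[OF assms, of "\<lambda>_. top_of_set {0..1::real}"]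
    continuous_map_into_fulltopology by blast

text \<open>By Tychonoff the cube is compact, and the characters are closed in it because each
  morphism law equates two continuous functions of \<open>h\<close>.\<close>

lemma compact_character_space: "compact_space (character_space A)"
proof -
  \<comment> \<open>\<open>closedin_INT\<close> asks for a nonempty index set.\<close>
  have not_empty: "\<C> \<noteq> {}"
    using zero_closed by blast
  let ?P = "product_topology (\<lambda>_. top_of_set {0..1::real}) \<C>"
  have top: "topspace ?P = \<C> \<rightarrow>\<^sub>E {0..1}"
    by simp
  have eq: "closedin ?P {h \<in> topspace ?P. f h = g h}"
    if "continuous_map ?P euclideanreal f" "continuous_map ?P euclideanreal g" for f g
    using that by (intro closedin_continuous_maps_eq[of euclideanreal]) auto
  have "closedin ?P ({h \<in> topspace ?P. h \<zero> = 0}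
      \<inter> (\<Inter>x\<in>\<C>. {h \<in> topspace ?P. h (\<sim> x) = 1 - h x})
      \<inter> (\<Inter>x\<in>\<C>. \<Inter>y\<in>\<C>. {h \<in> topspace ?P. h (x \<oplus> y) = min 1 (h x + h y)}))" (is "closedin _ ?H")
    by (intro closedin_Int closedin_INT eq continuous_map_evaluation continuous_map_real_min
        continuous_intros not_empty) auto
  moreover have "?H = mv_characters A"
    by (auto simp: mv_characters_iff top[symmetric] simp del: topspace_product_topology)
  ultimately have "closedin ?P (mv_characters A)" by simp
  moreover have "compact_space ?P"
    by (simp add: compact_space_product_topology compact_space_subtopology)
  ultimately show ?thesis
    unfolding character_space_def by (intro compact_space_subtopology closedin_compact_space)
qed

lemma continuous_map_character_value:
  "x \<in> \<C> \<Longrightarrow> continuous_map (character_space A) euclideanreal (\<lambda>h. h x)"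
  unfolding character_space_def
  by (intro continuous_map_from_subtopology continuous_map_evaluation)

lemma closedin_zero_locus:
  assumes "a \<in> \<C>"
  shows "closedin (character_space A) (zero_locus A a)"
proof -
  have "closedin (character_space A) {h \<in> topspace (character_space A). h a \<in> {0}}"
    by (intro closedin_continuous_map_preimage[OF continuous_map_character_value] assms) auto
  then show ?thesis
    by (simp add: zero_locus_def topspace_character_space)
qed

text \<open>Zero loci are the preimages of the generating open sets. The topology \<open>X\<close>
  is left open so that the lemma serves both the product and the coZariski topology on
  characters.\<close>

lemma continuous_map_kernel_iff:
  assumes top: "topspace X = mv_characters A"
  shows "continuous_map X (maximal_spectrum A) (character_kernel A) \<longleftrightarrow>
    (\<forall>a\<in>\<C>. openin X (zero_locus A a))"
proof -
  have "(\<Union>a\<in>\<C>. {M \<in> maximal_ideals A. a \<in> M}) = maximal_ideals A"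
    using topspace_maximal_spectrum by (simp add: maximal_spectrum_def topology_generated_by_topspace)
  moreover have "character_kernel A ` mv_characters A \<subseteq> maximal_ideals A"
    using character_kernel_maximal by blast
  moreover have "character_kernel A -` {M \<in> maximal_ideals A. a \<in> M} \<inter> mv_characters A
      = zero_locus A a" if "a \<in> \<C>" for a
    using that character_kernel_maximal by (auto simp: zero_locus_def character_kernel_def)
  ultimately show ?thesis
    unfolding maximal_spectrum_def continuous_on_generated_topo_iff
    unfolding Ball_def[symmetric] ball_simps top by auto
qed

lemma character_kernel_zero_locus:
  assumes "a \<in> \<C>"
  shows "character_kernel A ` zero_locus A a = {M \<in> maximal_ideals A. a \<in> M}"
proof
  show "character_kernel A ` zero_locus A a \<subseteq> {M \<in> maximal_ideals A. a \<in> M}"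
    using assms character_kernel_maximal by (auto simp: zero_locus_def character_kernel_def)
  show "{M \<in> maximal_ideals A. a \<in> M} \<subseteq> character_kernel A ` zero_locus A a"
  proof
    fix M assume M: "M \<in> {M \<in> maximal_ideals A. a \<in> M}"
    then obtain h where h: "h \<in> mv_characters A" "character_kernel A h = M"
      using maximal_ideal_character by blast
    then have "h \<in> zero_locus A a"
      using M by (auto simp: zero_locus_def character_kernel_def)
    with h show "M \<in> character_kernel A ` zero_locus A a" by blast
  qed
qed

text \<open>The kernel map is a bijection under which the two bases correspond, so it is continuous
  and open.\<close>

lemma homeomorphic_map_character_kernel:
  "homeomorphic_map (coZariski_character_space A) (maximal_spectrum A) (character_kernel A)"
proof (rule bijective_open_imp_homeomorphic_map)
  note top = topspace_coZariski_character_space topspace_maximal_spectrum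
  show inj: "inj_on (character_kernel A) (topspace (coZariski_character_space A))"
    and surj: "character_kernel A ` topspace (coZariski_character_space A) = topspace (maximal_spectrum A)"
    using character_kernel_bij by (simp_all add: top bij_betw_def)
  have "openin (coZariski_character_space A) (zero_locus A a)" if "a \<in> \<C>" for a
    unfolding openin_coZariski_character_space using that by (intro exI[of _ "{a}"]) simp
  then show "continuous_map (coZariski_character_space A) (maximal_spectrum A) (character_kernel A)"
    by (simp add: continuous_map_kernel_iff top)
  show "open_map (coZariski_character_space A) (maximal_spectrum A) (character_kernel A)"
    unfolding open_map_def
  proof (intro allI impI)
    fix U assume "openin (coZariski_character_space A) U"
    then obtain S where S: "S \<subseteq> \<C>" "U = (\<Union>a\<in>S. zero_locus A a)"
      using openin_coZariski_character_space by blast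
    then have "character_kernel A ` U = (\<Union>a\<in>S. {M \<in> maximal_ideals A. a \<in> M})"
      using character_kernel_zero_locus by (simp add: image_UN subset_iff)
    then show "openin (maximal_spectrum A) (character_kernel A ` U)"
      unfolding openin_maximal_spectrum using S(1) by (intro exI[of _ S]) simp
  qed
qed

text \<open>Two maximal ideals are separated by some \<open>a\<close> and \<open>\<not>(na)\<close>, since no proper ideal contains both.\<close>

lemma Hausdorff_maximal_spectrum: "Hausdorff_space (maximal_spectrum A)"
  unfolding Hausdorff_space_def
proof (intro allI impI)
  fix M N assume "M \<in> topspace (maximal_spectrum A) \<and> N \<in> topspace (maximal_spectrum A) \<and> M \<noteq> N"
  then have MN: "M \<in> maximal_ideals A" "N \<in> maximal_ideals A" "M \<noteq> N"
    by (simp_all add: topspace_maximal_spectrum)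
  then have "\<not> M \<subseteq> N"
    unfolding maximal_ideals_def by blast
  then obtain a where a: "a \<in> M" "a \<notin> N"
    by blast
  then have aC: "a \<in> \<C>"
    using maximal_idealD(2)[OF MN(1)] by blast
  obtain g where g: "g \<in> mv_characters A" "character_kernel A g = N"
    using maximal_ideal_character MN by blast
  have "0 < g a"
    using g a aC characterD(4)[OF g(1) aC] by (auto simp: character_kernel_def less_le)
  then obtain n :: nat where n: "1 < real n * g a"
    using reals_Archimedean3 by blast
  define b where "b = \<sim> (mv_multiple A n a)"
  have b: "b \<in> \<C>" "b \<in> N"
    using n aC g by (auto simp: b_def character_kernel_def characterD[OF g(1)] character_multiple)
  let ?U = "\<lambda>a. {M \<in> maximal_ideals A. a \<in> M}"
  have op: "openin (maximal_spectrum A) (?U c)" if "c \<in> \<C>" for c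
    unfolding openin_maximal_spectrum using that by (intro exI[of _ "{c}"]) simp
  have "disjnt (?U a) (?U b)"
    unfolding disjnt_iff
  proof (intro allI notI)
    fix L assume "L \<in> ?U a \<and> L \<in> ?U b"
    then obtain h where h: "h \<in> mv_characters A" "character_kernel A h = L" "a \<in> L" "b \<in> L"
      using maximal_ideal_character by blast
    then have "h a = 0" "h b = 0"
      by (auto simp: character_kernel_def)
    then show False
      using aC by (simp add: b_def characterD[OF h(1)] character_multiple[OF h(1)])
  qed
  then show "\<exists>U V. openin (maximal_spectrum A) U \<and> openin (maximal_spectrum A) V \<and> M \<in> U \<and> N \<in> V \<and> disjnt U V"
    using op[OF aC] op[OF b(1)] MN a b by blast
qed

text \<open>A continuous bijection from a compact space to a Hausdorff space is a
  homeomorphism.\<close>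

lemma continuous_kernel_imp_homeomorphic:
  assumes "continuous_map (character_space A) (maximal_spectrum A) (character_kernel A)"
  shows "homeomorphic_map (character_space A) (maximal_spectrum A) (character_kernel A)"
  using assms compact_character_space Hausdorff_maximal_spectrum character_kernel_bij
  by (intro continuous_imp_homeomorphic_map)
    (simp_all add: bij_betw_def topspace_character_space topspace_maximal_spectrum)

text \<open>The gap in the values at \<open>a\<close> turns the closed condition
  \<open>h a = 0\<close> into the open condition \<open>real n * h a < 1\<close>.\<close>

lemma quasihyperarchimedean_imp_open:
  assumes "quasihyperarchimedean A" and a: "a \<in> \<C>"
  shows "openin (character_space A) (zero_locus A a)"
proof -
  obtain n :: nat where n: "\<forall>h\<in>mv_characters A. h a = 0 \<or> 1 \<le> real n * h a"
    using assms by (auto simp: quasihyperarchimedean_def quasiarchimedean_iff)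
  have "openin (character_space A) {h \<in> topspace (character_space A). real n * h a \<in> {..<1}}"
    by (intro openin_continuous_map_preimage[where Y = euclideanreal] continuous_intros
        continuous_map_character_value a) auto
  moreover have "{h \<in> topspace (character_space A). real n * h a \<in> {..<1}} = zero_locus A a"
    using n by (force simp: topspace_character_space zero_locus_def)
  ultimately show ?thesis by simp
qed

text \<open>A character with \<open>h(a) > 0\<close> vanishes at some \<open>\<not>(na)\<close>, and a finite subcover bounds \<open>n\<close>.\<close>

lemma compact_imp_quasihyperarchimedean:
  assumes "compact_space (coZariski_character_space A)"
  shows "quasihyperarchimedean A"
  unfolding quasihyperarchimedean_def
proof
  fix a assume a: "a \<in> \<C>"
  define W where "W n = zero_locus A a \<union> zero_locus A (\<sim> (mv_multiple A n a))" for n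
  have "openin (coZariski_character_space A) (zero_locus A c)" if "c \<in> \<C>" for c
    unfolding openin_coZariski_character_space using that by (intro exI[of _ "{c}"]) simp
  then have "openin (coZariski_character_space A) (W n)" for n
    using a by (simp add: W_def openin_Un)
  then have op: "openin (coZariski_character_space A) U" if "U \<in> range W" for U
    using that by blast
  have cover: "mv_characters A \<subseteq> \<Union>(range W)"
  proof
    fix h assume h: "h \<in> mv_characters A"
    show "h \<in> \<Union>(range W)"
    proof (cases "h a = 0")
      case False
      then obtain n :: nat where "1 < real n * h a"
        using characterD(4)[OF h a] reals_Archimedean3[of "h a"] by fastforce
      then have "h \<in> W n"
        using h a by (simp add: W_def zero_locus_def characterD(2)[OF h] character_multiple[OF h])
      then show ?thesis by blast
    qed (use h in \<open>simp add: W_def zero_locus_def\<close>)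
  qed
  have "compactin (coZariski_character_space A) (mv_characters A)"
    using assms by (simp add: compact_space_def topspace_coZariski_character_space)
  from compactinD[OF this op cover] obtain F where F: "finite F" "F \<subseteq> range W" "mv_characters A \<subseteq> \<Union>F"
    by blast
  then obtain I where I: "finite I" "F = W ` I"
    using finite_subset_image[of F W UNIV] by blast
  \<comment> \<open>One multiplier has to work for all characters, and enlarging it is harmless. The
    inserted 0 keeps the maximum defined when the subcover is empty.\<close>
  have "h a = 0 \<or> 1 \<le> real (Max (insert 0 I)) * h a" if h: "h \<in> mv_characters A" for h
  proof -
    obtain i where i: "i \<in> I" "h \<in> W i"
      using F I h by blast
    show ?thesis
    proof (cases "h a = 0")
      case False
      then have "1 \<le> real i * h a"
        using i a h
        by (auto simp: W_def zero_locus_def characterD(2)[OF h] character_multiple[OF h] min_def split: if_splits)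
      also have "real i * h a \<le> real (Max (insert 0 I)) * h a"
        using i I characterD(4)[OF h a] by (intro mult_right_mono) auto
      finally show ?thesis by simp
    qed simp
  qed
  then show "quasiarchimedean A a"
    using a by (auto simp: quasiarchimedean_iff)
qed

lemma compact_spectrum_iff:
  "compact_space (maximal_spectrum A) \<longleftrightarrow> compact_space (coZariski_character_space A)"
  using homeomorphic_map_character_kernel homeomorphic_compact_space
    homeomorphic_map_imp_homeomorphic_space by blast

lemma continuous_kernel_imp_compact:
  assumes "continuous_map (character_space A) (maximal_spectrum A) (character_kernel A)"
  shows "compact_space (maximal_spectrum A)"
  using continuous_kernel_imp_homeomorphic[OF assms] compact_character_space
    homeomorphic_compact_space homeomorphic_map_imp_homeomorphic_space by blast

end

theorem proposition2p6:
  fixes A :: "('a, 'b) mv_structure_scheme"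
  assumes "mv_algebra A"
  shows "homeomorphic_map (coZariski_character_space A) (maximal_spectrum A) (character_kernel A)
    \<and> (quasihyperarchimedean A \<longleftrightarrow>
        (\<forall>a\<in>mv_carrier A. openin (character_space A) (zero_locus A a)))
    \<and> (quasihyperarchimedean A \<longleftrightarrow>
        continuous_map (character_space A) (maximal_spectrum A) (character_kernel A \<circ> id))
    \<and> (quasihyperarchimedean A \<longleftrightarrow> compact_space (maximal_spectrum A))
    \<and> ((\<forall>a\<in>mv_carrier A. openin (character_space A) (zero_locus A a)) \<longrightarrow>
        (\<forall>a\<in>mv_carrier A. openin (character_space A) (zero_locus A a) \<and>
                           closedin (character_space A) (zero_locus A a)))
    \<and> (continuous_map (character_space A) (maximal_spectrum A) (character_kernel A \<circ> id) \<longrightarrow>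
        homeomorphic_map (character_space A) (maximal_spectrum A) (character_kernel A \<circ> id))"
proof -
  interpret mv_algebra A by (rule assms)
  have "quasihyperarchimedean A \<longleftrightarrow> (\<forall>a\<in>mv_carrier A. openin (character_space A) (zero_locus A a))"
    and "quasihyperarchimedean A \<longleftrightarrow> compact_space (maximal_spectrum A)"
    \<comment> \<open>The implications form a cycle: quasihyperarchimedean, open zero loci,
      continuous kernel map, compact spectrum, and back.\<close>
    using quasihyperarchimedean_imp_open continuous_map_kernel_iff[OF topspace_character_space] continuous_kernel_imp_compact
      compact_spectrum_iff compact_imp_quasihyperarchimedean
    by blast+
  then show ?thesis
    unfolding comp_id
    using homeomorphic_map_character_kernel continuous_map_kernel_iff[OF topspace_character_space]
      continuous_kernel_imp_homeomorphic closedin_zero_locus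
    by blast
qed

end
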